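(* Let $K \subset \mathbb{R}^2$ be a centrally symmetric convex body with centre of symmetry $O$. Let $X$ be a uniformly distributed random point in $K$ and $Y$ a uniformly distributed random point on the boundary $\partial K$. Then for every direction $u$ the random variable $|P_u(OY)|$ stochastically dominates $|P_u(OX)|$, that is, for all $t \ge 0$, $$\mathbb{P}\bigl(|P_u(OY)| \le t\bigr) \le \mathbb{P}\bigl(|P_u(OX)| \le t\bigr).$$
   Context: A convex body is a convex compact set with non-empty interior. "Uniform in $K$" is with respect to Lebesgue measure; "uniform on $\partial K$" is with respect to arc length. A direction $u$ is a unit vector in $\mathbb{R}^2$, and $P_u$ is orthogonal projection onto the line spanned by $u$, so $|P_u(OZ)| = |\langle Z - O, u\rangle|$. *)

theory Defs
  imports "HOL-Probability.Probability"
begin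

definition convex_body :: "'a::euclidean_space set \<Rightarrow> bool" where
  "convex_body K \<longleftrightarrow> convex K \<and> compact K \<and> interior K \<noteq> {}"

definition centrally_symmetric :: "'a::real_vector set \<Rightarrow> 'a \<Rightarrow> bool" where
  "centrally_symmetric K c \<longleftrightarrow> (\<forall>x\<in>K. 2 *\<^sub>R c - x \<in> K)"

(* The formula is the orthogonal projection onto the line spanned by u only when norm u = 1. *)
definition proj_line :: "'a::real_inner \<Rightarrow> 'a \<Rightarrow> 'a" where
  "proj_line u v = (v \<bullet> u) *\<^sub>R u"

(* Supremum of the lengths of the inscribed polygonal lines; repeated points in xs add nothing. *)
definition curve_length :: "(real \<Rightarrow> 'a::metric_space) \<Rightarrow> real \<Rightarrow> real \<Rightarrow> ennreal" where
  "curve_length \<gamma> a b =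
     (SUP xs\<in>{xs. sorted xs \<and> set xs \<subseteq> {a..b}}.
        \<Sum>i<length xs - 1. ennreal (dist (\<gamma> (xs ! i)) (\<gamma> (xs ! Suc i))))"

definition arc_length_parametrization ::
    "(real \<Rightarrow> 'a::metric_space) \<Rightarrow> real \<Rightarrow> 'a set \<Rightarrow> bool" where
  "arc_length_parametrization \<gamma> L C \<longleftrightarrow>
     0 < L \<and> continuous_on {0..L} \<gamma> \<and> inj_on \<gamma> {0..<L} \<and> \<gamma> L = \<gamma> 0 \<and> \<gamma> ` {0..L} = C \<and>
     (\<forall>s t. 0 \<le> s \<and> s \<le> t \<and> t \<le> L \<longrightarrow> curve_length \<gamma> s t = ennreal (t - s))"

(* \<sigma> is arc length on the closed simple curve C: the image of Lebesgue measure on [0, L] under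
   a parametrization by arc length.  It does not depend on the parametrization, since any two of
   them differ only by a shift of the starting point modulo L and a change of orientation. *)
definition is_arc_length_measure :: "'a::metric_space measure \<Rightarrow> 'a set \<Rightarrow> bool" where
  "is_arc_length_measure \<sigma> C \<longleftrightarrow>
     (\<exists>\<gamma> L. arc_length_parametrization \<gamma> L C \<and> \<sigma> = distr (restrict_space lborel {0..L}) borel \<gamma>)"

definition uniformly_distributed ::
    "'p measure \<Rightarrow> 'a measure \<Rightarrow> 'a set \<Rightarrow> ('p \<Rightarrow> 'a) \<Rightarrow> bool" where
  "uniformly_distributed M \<mu> A Z \<longleftrightarrow> Z \<in> measurable M \<mu> \<and> distr M \<mu> Z = uniform_measure \<mu> A"

end

theory Submission
  imports Defs
begin

text \<open>
  Take \<open>c = 0\<close> and let \<open>u\<close> be the first axis, so that the line \<open>s = t\<close> cuts \<open>K\<close> in a chord of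
  length \<open>d = p - q\<close>. Let \<open>\<alpha> \<le> \<beta>\<close> be the slopes of supporting lines at its upper and lower ends, let
  \<open>g\<close> be the one of larger absolute value, and put \<open>\<phi> = sqrt (1 + g\<^sup>2)\<close>. Between the lines \<open>s = - t\<close> and
  \<open>s = t\<close> the slopes of the upper boundary arc lie in \<open>[\<alpha>, \<beta>]\<close>, so the boundary there has length at
  most \<open>4 t \<phi>\<close>, while the area is at least \<open>2 t d\<close> because the region contains a parallelogram.
  The cap \<open>s > t\<close> lies between the lines of slope \<open>g\<close> through the ends of the chord. If the ray of
  slope \<open>g\<close> from the midpoint of the chord leaves \<open>K\<close> after horizontal distance \<open>x\<close>, then the cap has
  area at most \<open>x d\<close>, since the cap and its reflection in the exit point meet only on a supporting
  line and fit into a parallelogram of area \<open>2 x d\<close>, and its boundary arc has length at least \<open>2 x \<phi>\<close>,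
  since it passes through the exit point. Hence middle length times area of the caps is at most
  \<open>(4 t \<phi>) (2 x d) = (4 x \<phi>) (2 t d)\<close>, which is at most length of the cap arcs times middle area.
\<close>

section \<open>Lebesgue measure of images on the real line\<close>

text \<open>The components do it: they are open and pairwise disjoint, hence countable. Estimates
  that hold on intervals can then be summed to estimates on open sets.\<close>

lemma open_real_disjoint_connected_Union:
  fixes E :: "real set"
  assumes "open E"
  obtains C :: "nat \<Rightarrow> real set" where "disjoint_family C" "(\<Union>n. C n) = E"
    "\<And>n. open (C n)" "\<And>n. connected (C n)"
proof -
  have dj: "pairwise disjnt (components E)"
    using pairwise_disjoint_components by (auto simp: pairwise_def disjnt_def)
  have op: "open U" if "U \<in> components E" for U
    using that assms open_components by blast
  have co: "countable (components E)"
    using countable_disjoint_open_subsets[of "components E"] op dj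
    by (simp add: disjoint_def pairwise_def disjnt_def)
  \<comment> \<open>Indices that code no component get the empty set: \<open>from_nat_into\<close>
    would return some component again there and spoil disjointness.\<close>
  define C where "C n = (if n \<in> to_nat_on (components E) ` components E
      then from_nat_into (components E) n else {})" for n
  have C_to_nat: "C (to_nat_on (components E) U) = U" if "U \<in> components E" for U
    using that co by (simp add: C_def)
  have C_cases: "C n = {} \<or> (\<exists>U\<in>components E. n = to_nat_on (components E) U \<and> C n = U)" for n
  proof (cases "n \<in> to_nat_on (components E) ` components E")
    case True
    then obtain U where "U \<in> components E" "n = to_nat_on (components E) U" by blast
    then show ?thesis using C_to_nat[of U] by metis
  qed (simp add: C_def)
  show thesis
  proof
    show "disjoint_family C"
      unfolding disjoint_family_on_def
    proof (intro ballI impI)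
      fix m n :: nat
      assume "m \<noteq> n"
      then consider "C m = {}" | "C n = {}"
        | "C m \<in> components E" "C n \<in> components E" "C m \<noteq> C n"
        using C_cases[of m] C_cases[of n] by metis
      then show "C m \<inter> C n = {}"
        by cases (use dj in \<open>auto simp only: pairwise_def disjnt_def\<close>)
    qed
    have "C n \<subseteq> E" for n using C_cases[of n] in_components_subset[of "C n" E] by auto
    moreover have "x \<in> (\<Union>n. C n)" if "x \<in> E" for x
    proof -
      have "x \<in> \<Union>(components E)" using that by simp
      then obtain U where "U \<in> components E" "x \<in> U" by blast
      then show ?thesis using C_to_nat[of U] by blast
    qed
    ultimately show "(\<Union>n. C n) = E" by blast
    show "open (C n)" for n using C_cases[of n] op by auto
    show "connected (C n)" for n using C_cases[of n] in_components_connected by auto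
  qed
qed

text \<open>Everything lies in the interval of length \<open>m\<close> that starts at
  \<open>Inf S\<close>. For non-measurable \<open>S\<close> the left side is zero by
  convention.\<close>

lemma emeasure_lborel_le_if_diam_le:
  fixes S :: "real set"
  assumes "\<And>x y. x \<in> S \<Longrightarrow> y \<in> S \<Longrightarrow> x \<le> y \<Longrightarrow> y - x \<le> m" and "0 \<le> m"
  shows "emeasure lborel S \<le> ennreal m"
proof (cases "S = {}")
  case False
  then obtain s where s: "s \<in> S" by blast
  have d: "y - x \<le> m" if "x \<in> S" "y \<in> S" for x y
    using assms that by (cases "x \<le> y") auto
  have bb: "bdd_below S" using d s by (intro bdd_belowI[of _ "s - m"]) force
  have "y \<le> Inf S + m" if "y \<in> S" for y
  proof -
    have "y - m \<le> Inf S" using d that False by (intro cInf_greatest) force+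
    then show ?thesis by simp
  qed
  then have "S \<subseteq> {Inf S .. Inf S + m}" using bb by (auto intro: cInf_lower)
  then have "emeasure lborel S \<le> emeasure lborel {Inf S .. Inf S + m}"
    by (intro emeasure_mono) auto
  then show ?thesis using assms(2) by simp
qed auto

lemma connected_diff_le_emeasure_lborel:
  fixes S :: "real set"
  assumes "connected S" "S \<in> sets borel" "x \<in> S" "y \<in> S" "x \<le> y"
  shows "ennreal (y - x) \<le> emeasure lborel S"
proof -
  have "{x..y} \<subseteq> S" using assms connected_contains_Icc by blast
  then have "emeasure lborel {x..y} \<le> emeasure lborel S" using assms by (intro emeasure_mono) auto
  then show ?thesis using assms by simp
qed

text \<open>On each component the image is connected, hence an interval, and the image of
  \<open>E\<close> is a countable union of these.\<close>

lemma borel_continuous_image_open: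
  fixes f :: "real \<Rightarrow> real"
  assumes "open E" "continuous_on E f"
  shows "f ` E \<in> sets borel"
proof -
  obtain C :: "nat \<Rightarrow> real set" where C: "(\<Union>n. C n) = E" "\<And>n. connected (C n)"
    using open_real_disjoint_connected_Union[OF assms(1)] by metis
  have "f ` C n \<in> sets borel" for n
    using C assms(2)
    by (intro real_interval_borel_measurable)
      (auto simp: is_interval_connected_1 intro!: connected_continuous_image intro: continuous_on_subset)
  then have "(\<Union>n. f ` C n) \<in> sets borel" by auto
  then show ?thesis by (simp add: C(1)[symmetric] image_UN)
qed

text \<open>A component of length \<open>m\<close> has an image of diameter at most
  \<open>m\<close>; sum over the components. Applied to a projection of the boundary curve, this
  bounds arc length from below.\<close>

lemma emeasure_lborel_short_image_le:
  fixes f :: "real \<Rightarrow> real"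
  assumes E: "open E" "bounded E"
    and short: "\<And>x y. x \<in> E \<Longrightarrow> y \<in> E \<Longrightarrow> \<bar>f x - f y\<bar> \<le> \<bar>x - y\<bar>"
  shows "emeasure lborel (f ` E) \<le> emeasure lborel E"
proof -
  obtain C :: "nat \<Rightarrow> real set" where C: "disjoint_family C" "(\<Union>n. C n) = E"
    "\<And>n. open (C n)" "\<And>n. connected (C n)"
    by (rule open_real_disjoint_connected_Union[OF E(1)]) (rule that)
  have CE: "C n \<subseteq> E" for n using C(2) by auto
  have cont: "continuous_on E f"
    unfolding continuous_on_iff dist_real_def
  proof (intro ballI allI impI)
    fix x e :: real assume "x \<in> E" "0 < e"
    then show "\<exists>d>0. \<forall>x'\<in>E. \<bar>x' - x\<bar> < d \<longrightarrow> \<bar>f x' - f x\<bar> < e"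
      using short by (intro exI[of _ e]) (auto intro: le_less_trans)
  qed
  have fin: "emeasure lborel (C n) < \<infinity>" for n
    by (rule emeasure_bounded_finite[OF bounded_subset[OF E(2) CE]])
  have meas: "f ` C n \<in> sets lborel" for n
    using borel_continuous_image_open[OF C(3) continuous_on_subset[OF cont CE]] by simp
  have le: "emeasure lborel (f ` C n) \<le> emeasure lborel (C n)" for n
  proof -
    have eq: "emeasure lborel (C n) = ennreal (measure lborel (C n))"
      using fin[of n] by (simp add: emeasure_eq_ennreal_measure)
    have "\<bar>y - x\<bar> \<le> measure lborel (C n)" if "x \<in> C n" "y \<in> C n" for x y
      using that(1,2)
    proof (induction x y rule: linorder_wlog)
      case (le x y)
      then have "ennreal (y - x) \<le> emeasure lborel (C n)"
        using C by (intro connected_diff_le_emeasure_lborel) auto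
      then show ?case using le by (simp add: eq)
    qed (simp add: abs_minus_commute)
    then have "\<bar>f y - f x\<bar> \<le> measure lborel (C n)" if "x \<in> C n" "y \<in> C n" for x y
      using that by (intro order_trans[OF short[of y x]] subsetD[OF CE[of n]]) auto
    then show ?thesis
      unfolding eq by (intro emeasure_lborel_le_if_diam_le) (auto simp: abs_le_iff)
  qed
  have "f ` E = (\<Union>n. f ` C n)" by (simp add: C(2)[symmetric] image_UN)
  then have "emeasure lborel (f ` E) \<le> (\<Sum>n. emeasure lborel (f ` C n))"
    using meas by (simp add: emeasure_subadditive_countably image_subset_iff)
  also have "\<dots> \<le> (\<Sum>n. emeasure lborel (C n))" by (intro suminf_le le) auto
  also have "\<dots> = emeasure lborel E"
    using C by (subst suminf_emeasure) auto
  finally show ?thesis .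
qed

text \<open>Since \<open>f\<close> is injective, the images of the components are disjoint intervals
  inside \<open>{a..b}\<close>, so their lengths add up to at most \<open>b - a\<close>. Expansion
  is demanded only across intervals contained in \<open>E\<close>, since it will come from the
  length of a curve piece that stays in \<open>E\<close>.\<close>

lemma emeasure_lborel_le_if_inj_expanding:
  fixes f :: "real \<Rightarrow> real"
  assumes E: "open E" "continuous_on E f" "inj_on f E" "0 \<le> k" "a \<le> b" "f ` E \<subseteq> {a..b}"
    and expand: "\<And>x y. x < y \<Longrightarrow> {x..y} \<subseteq> E \<Longrightarrow> y - x \<le> k * \<bar>f x - f y\<bar>"
  shows "emeasure lborel E \<le> ennreal (k * (b - a))"
proof -
  obtain C :: "nat \<Rightarrow> real set" where C: "disjoint_family C" "(\<Union>n. C n) = E"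
    "\<And>n. open (C n)" "\<And>n. connected (C n)"
    by (rule open_real_disjoint_connected_Union[OF E(1)]) (rule that)
  have CE: "C n \<subseteq> E" for n using C(2) by auto
  have cont: "continuous_on (C n) f" for n using CE E(2) continuous_on_subset by blast
  have meas: "f ` C n \<in> sets borel" for n
    using borel_continuous_image_open[OF C(3) cont] .
  have conn: "connected (f ` C n)" for n by (simp add: C cont connected_continuous_image)
  have fin: "emeasure lborel (f ` C n) < \<infinity>" for n
    by (rule emeasure_bounded_finite[OF bounded_subset[OF bounded_closed_interval
            order_trans[OF image_mono[OF CE] E(6)]]])
  have eq: "emeasure lborel (f ` C n) = ennreal (measure lborel (f ` C n))" for n
    using fin[of n] by (simp add: emeasure_eq_ennreal_measure)
  have le: "emeasure lborel (C n) \<le> ennreal k * emeasure lborel (f ` C n)" for n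
  proof -
    have diam: "\<bar>v - u\<bar> \<le> measure lborel (f ` C n)" if "u \<in> f ` C n" "v \<in> f ` C n" for u v
      using that(1,2)
    proof (induction u v rule: linorder_wlog)
      case (le u v)
      then have "ennreal (v - u) \<le> emeasure lborel (f ` C n)"
        using conn meas by (intro connected_diff_le_emeasure_lborel) auto
      then show ?case using le by (simp add: eq)
    qed (simp add: abs_minus_commute)
    have "y - x \<le> k * measure lborel (f ` C n)" if "x \<in> C n" "y \<in> C n" "x \<le> y" for x y
    proof (cases "x = y")
      case False
      have "{x..y} \<subseteq> C n" using C(4) that connected_contains_Icc by blast
      then have "y - x \<le> k * \<bar>f x - f y\<bar>" 
        using expand[of x y] False that CE[of n] by (meson order_le_less subset_trans)
      also have "\<dots> \<le> k * measure lborel (f ` C n)"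
        using diam that E(4) by (intro mult_left_mono) auto
      finally show ?thesis .
    qed (simp add: E(4))
    then show ?thesis
      unfolding eq ennreal_mult[OF E(4) measure_nonneg, symmetric]
      using E(4) by (intro emeasure_lborel_le_if_diam_le) auto
  qed
  have dj: "disjoint_family (\<lambda>n. f ` C n)"
    unfolding disjoint_family_on_def
  proof (intro ballI impI)
    fix m n :: nat assume "m \<noteq> n"
    then have "C m \<inter> C n = {}" using C(1) by (simp add: disjoint_family_on_def)
    then show "f ` C m \<inter> f ` C n = {}"
      using inj_on_image_Int[OF E(3) CE[of m] CE[of n]] by simp
  qed
  have "emeasure lborel E = (\<Sum>n. emeasure lborel (C n))"
    using C by (subst suminf_emeasure) auto
  also have "\<dots> \<le> (\<Sum>n. ennreal k * emeasure lborel (f ` C n))" by (intro suminf_le le) auto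
  also have "\<dots> = ennreal k * (\<Sum>n. emeasure lborel (f ` C n))" by simp
  also have "\<dots> = ennreal k * emeasure lborel (\<Union>n. f ` C n)"
    using meas dj by (subst suminf_emeasure) auto
  also have "\<dots> \<le> ennreal k * emeasure lborel {a..b}"
    using CE E(6) by (intro mult_left_mono emeasure_mono) auto
  also have "\<dots> = ennreal (k * (b - a))"
    using E(4,5) by (simp add: ennreal_mult)
  finally show ?thesis .
qed

section \<open>Length of curves\<close>

lemma curve_length_ge_dist:
  assumes "a \<le> b"
  shows "ennreal (dist (\<gamma> a) (\<gamma> b)) \<le> curve_length \<gamma> a b"
  unfolding curve_length_def
  by (rule SUP_upper2[of "[a, b]"]) (use assms in auto)

lemma arc_length_parametrization_short:
  assumes "arc_length_parametrization \<gamma> L C" "x \<in> {0..L}" "y \<in> {0..L}"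
  shows "dist (\<gamma> x) (\<gamma> y) \<le> \<bar>x - y\<bar>"
  using assms(2,3)
proof (induction x y rule: linorder_wlog)
  case (le x y)
  have "ennreal (dist (\<gamma> x) (\<gamma> y)) \<le> curve_length \<gamma> x y" using le curve_length_ge_dist by blast
  also have "\<dots> = ennreal (y - x)"
    using le assms(1) by (auto simp: arc_length_parametrization_def)
  finally show ?case using le by simp
qed (simp add: dist_commute abs_minus_commute)

text \<open>Each side of an inscribed polygonal line is bounded by an increment of
  \<open>k * f\<close>, and these increments telescope.\<close>

lemma curve_length_le_mono:
  fixes f :: "real \<Rightarrow> real"
  assumes mono: "\<And>x y. a \<le> x \<Longrightarrow> x \<le> y \<Longrightarrow> y \<le> b \<Longrightarrow> f x \<le> f y"
    and dist: "\<And>x y. a \<le> x \<Longrightarrow> x \<le> y \<Longrightarrow> y \<le> b \<Longrightarrow> dist (\<gamma> x) (\<gamma> y) \<le> k * (f y - f x)"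
    and "0 \<le> k" "a \<le> b"
  shows "curve_length \<gamma> a b \<le> ennreal (k * (f b - f a))"
  unfolding curve_length_def
proof (rule SUP_least)
  fix xs assume "xs \<in> {xs. sorted xs \<and> set xs \<subseteq> {a..b}}"
  then have xs: "sorted xs" "set xs \<subseteq> {a..b}" by auto
  have nth: "a \<le> xs ! i" "xs ! i \<le> b" if "i < length xs" for i
    using xs nth_mem[OF that] by auto
  define n where "n = length xs - 1"
  have "(\<Sum>i<n. ennreal (dist (\<gamma> (xs ! i)) (\<gamma> (xs ! Suc i))))
      = ennreal (\<Sum>i<n. dist (\<gamma> (xs ! i)) (\<gamma> (xs ! Suc i)))" by simp
  also have "\<dots> \<le> ennreal (\<Sum>i<n. k * (f (xs ! Suc i) - f (xs ! i)))"
    using xs nth by (intro ennreal_leI sum_mono dist) (auto simp: n_def sorted_wrt_nth_less sorted_nth_mono)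
  also have "(\<Sum>i<n. k * (f (xs ! Suc i) - f (xs ! i))) = k * (f (xs ! n) - f (xs ! 0))"
    using sum_lessThan_telescope[of "\<lambda>i. f (xs ! i)" n]
    by (simp only: sum_distrib_left[symmetric])
  also have "\<dots> \<le> k * (f b - f a)"
  \<comment> \<open>For the empty list \<open>n\<close> is 0, so the two unspecified values at
    \<open>xs ! 0\<close> cancel and only monotonicity of \<open>f\<close> is left.\<close>
  proof (cases "xs = []")
    case False
    then have "f (xs ! n) \<le> f b" "f a \<le> f (xs ! 0)"
      using nth[of 0] nth[of n] assms by (auto simp: n_def intro!: mono)
    then show ?thesis using assms by (intro mult_left_mono) auto
  qed (use assms mono[of a b] in \<open>auto simp: n_def\<close>)
  finally show "(\<Sum>i<length xs - 1. ennreal (dist (\<gamma> (xs ! i)) (\<gamma> (xs ! Suc i))))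
      \<le> ennreal (k * (f b - f a))"
    unfolding n_def using ennreal_leI by fastforce
qed

lemma continuous_inj_imp_mono_or_antimono:
  fixes f :: "real \<Rightarrow> real"
  assumes "continuous_on {a..b} f" "inj_on f {a..b}"
  shows "(\<forall>x y. a \<le> x \<and> x \<le> y \<and> y \<le> b \<longrightarrow> f x \<le> f y) \<or> (\<forall>x y. a \<le> x \<and> x \<le> y \<and> y \<le> b \<longrightarrow> f y \<le> f x)"
  using injective_eq_monotone_map[of "{a..b}" f] assms
  by (auto simp: monotone_on_def order_le_less)

text \<open>A continuous injective \<open>f\<close> is monotone one way or the other, so the
  telescoping bound applies to \<open>f\<close> or to \<open>- f\<close>.\<close>

lemma curve_length_le_inj:
  fixes f :: "real \<Rightarrow> real"
  assumes "continuous_on {a..b} f" "inj_on f {a..b}" "0 \<le> k" "a \<le> b"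
    and dist: "\<And>x y. x \<in> {a..b} \<Longrightarrow> y \<in> {a..b} \<Longrightarrow> dist (\<gamma> x) (\<gamma> y) \<le> k * \<bar>f x - f y\<bar>"
  shows "curve_length \<gamma> a b \<le> ennreal (k * \<bar>f a - f b\<bar>)"
  using continuous_inj_imp_mono_or_antimono[OF assms(1,2)]
proof (elim disjE)
  assume m: "\<forall>x y. a \<le> x \<and> x \<le> y \<and> y \<le> b \<longrightarrow> f x \<le> f y"
  have "curve_length \<gamma> a b \<le> ennreal (k * (f b - f a))"
  proof (rule curve_length_le_mono)
    fix x y assume "a \<le> x" "x \<le> y" "y \<le> b"
    then show "f x \<le> f y" "dist (\<gamma> x) (\<gamma> y) \<le> k * (f y - f x)" using m dist[of x y] by auto
  qed (use assms in auto)
  then show ?thesis using m assms(4) by (simp add: abs_minus_commute)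
next
  assume m: "\<forall>x y. a \<le> x \<and> x \<le> y \<and> y \<le> b \<longrightarrow> f y \<le> f x"
  have "curve_length \<gamma> a b \<le> ennreal (k * (- f b - - f a))"
  proof (rule curve_length_le_mono)
    fix x y assume "a \<le> x" "x \<le> y" "y \<le> b"
    then show "- f x \<le> - f y" "dist (\<gamma> x) (\<gamma> y) \<le> k * (- f y - - f x)" using m dist[of x y] by auto
  qed (use assms in auto)
  then show ?thesis using m assms(4) by simp
qed

section \<open>Symmetric planar bodies and their chords\<close>

lemma convex_interior_combination:
  fixes K :: "'a::euclidean_space set"
  assumes "convex K" "a \<in> interior K" "b \<in> K" "0 \<le> l" "l < 1"
  shows "(1 - l) *\<^sub>R a + l *\<^sub>R b \<in> interior K"
proof -
  have "(1 - l) *\<^sub>R a + l *\<^sub>R b = b - (1 - l) *\<^sub>R (b - a)" by (simp add: algebra_simps)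
  then show ?thesis using mem_interior_convex_shrink[of K a b "1 - l"] assms by simp
qed

text \<open>Coordinates for the proof: the centre is the origin and the direction is the first axis,
  so that the strip condition becomes a bound on the first coordinate.\<close>

locale sym_planar_body =
  fixes K :: "(real \<times> real) set"
  assumes cv: "convex K" and cp: "compact K" and zero_int: "0 \<in> interior K"
    and sym: "\<And>s y. (s, y) \<in> K \<Longrightarrow> (- s, - y) \<in> K"
begin

lemma combination:
  assumes "(s1, y1) \<in> K" "(s2, y2) \<in> K" "0 \<le> l" "l \<le> 1"
  shows "((1 - l) * s1 + l * s2, (1 - l) * y1 + l * y2) \<in> K"
  using convexD_alt[OF cv assms] by simp

lemma interior_combination:
  assumes "(s1, y1) \<in> interior K" "(s2, y2) \<in> K" "0 \<le> l" "l < 1"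
  shows "((1 - l) * s1 + l * s2, (1 - l) * y1 + l * y2) \<in> interior K"
  using convex_interior_combination[OF cv assms] by simp

lemma vertical_interior:
  assumes "(s, y1) \<in> interior K" "(s, y2) \<in> K" "y1 \<le> y \<and> y < y2 \<or> y2 < y \<and> y \<le> y1"
  shows "(s, y) \<in> interior K"
proof -
  define l where "l = (y - y1) / (y2 - y1)"
  have l: "0 \<le> l" "l < 1" using assms(3) by (auto simp: l_def divide_simps)
  have "l * (y2 - y1) = y - y1" using assms(3) by (auto simp: l_def)
  then have "(1 - l) * y1 + l * y2 = y" by algebra
  moreover have "(1 - l) * s + l * s = s" by (simp add: algebra_simps)
  ultimately show ?thesis using interior_combination[OF assms(1,2) l] by simp
qed

lemma interior_vertical_nhd:
  assumes "(s, y) \<in> interior K"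
  obtains e where "0 < e" "(s, y + e) \<in> K" "(s, y - e) \<in> K"
proof -
  obtain e where e: "0 < e" "cball (s, y) e \<subseteq> K"
    using assms by (auto simp: mem_interior_cball)
  have "(s, y + e) \<in> cball (s, y) e" "(s, y - e) \<in> cball (s, y) e"
    using e by (auto simp: dist_Pair_Pair dist_real_def)
  then show thesis using e that by blast
qed

lemma closed_K: "closed K" using cp compact_imp_closed by blast

lemma frontier_in_K: "z \<in> frontier K \<Longrightarrow> z \<in> K"
  using closed_K by (auto simp: frontier_def)

text \<open>Strictness on the interior later decides the sign of a coefficient: evaluation at a
  known interior point excludes lines in unwanted directions.\<close>

lemma supporting_line:
  assumes "(s0, y0) \<in> K" "(s0, y0) \<notin> interior K"
  obtains a b where "\<And>s y. (s, y) \<in> K \<Longrightarrow> a * (s - s0) + b * (y - y0) \<le> 0"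
    "\<And>s y. (s, y) \<in> interior K \<Longrightarrow> a * (s - s0) + b * (y - y0) < 0"
proof -
  have ri: "rel_interior K = interior K"
    using zero_int rel_interior_nonempty_interior by blast
  obtain w where w: "\<And>z. z \<in> K \<Longrightarrow> w \<bullet> (s0, y0) \<le> w \<bullet> z"
      "\<And>z. z \<in> interior K \<Longrightarrow> w \<bullet> (s0, y0) < w \<bullet> z"
    using supporting_hyperplane_rel_boundary[OF cv assms(1)] assms(2) unfolding ri by metis
  obtain a b where ab: "w = (a, b)" by fastforce
  show thesis
  proof (rule that[of "- a" "- b"])
    fix s y assume "(s, y) \<in> K"
    then show "- a * (s - s0) + - b * (y - y0) \<le> 0"
      using w(1)[of "(s, y)"] by (simp add: ab algebra_simps)
  next
    fix s y assume "(s, y) \<in> interior K"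
    then show "- a * (s - s0) + - b * (y - y0) < 0"
      using w(2)[of "(s, y)"] by (simp add: ab algebra_simps)
  qed
qed

end

text \<open>The chord cut out by the line \<open>s = t\<close> runs from \<open>(t, q)\<close> up to \<open>(t, p)\<close>; \<open>\<alpha>\<close> and \<open>\<beta>\<close> are the
  slopes of supporting lines at its upper and its lower end.\<close>

locale chord = sym_planar_body +
  fixes t p q \<alpha> \<beta> :: real
  assumes t0: "0 \<le> t" and upper_mem: "(t, p) \<in> K" and lower_mem: "(t, q) \<in> K" and qp: "q < p"
    and ends: "\<And>y. (t, y) \<in> K \<Longrightarrow> q \<le> y \<and> y \<le> p"
    and mid_int: "(t, (p + q) / 2) \<in> interior K"
    and upper_support: "\<And>s y. (s, y) \<in> K \<Longrightarrow> y \<le> p + \<alpha> * (s - t)"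
    and lower_support: "\<And>s y. (s, y) \<in> K \<Longrightarrow> q + \<beta> * (s - t) \<le> y"
    and slopes: "\<alpha> \<le> \<beta>"

text \<open>A point beyond the line \<open>s = t\<close>, joined to the interior point 0, yields an
  interior point on that line. Hence the chord is nondegenerate and the supporting lines at its ends
  are not vertical.\<close>

lemma (in sym_planar_body) chord_exists:
  assumes "0 \<le> t" "(s0, y0) \<in> K" "t < s0"
  shows "\<exists>p q \<alpha> \<beta>. chord K t p q \<alpha> \<beta>"
proof -
  define l where "l = t / s0"
  have l: "0 \<le> l" "l < 1" "l * s0 = t" using assms by (auto simp: l_def)
  define n0 where "n0 = l * y0"
  have "(0, 0) \<in> interior K" using zero_int by (simp add: zero_prod_def)
  from interior_combination[OF this assms(2) l(1,2)]
  have n0: "(t, n0) \<in> interior K" by (simp add: l n0_def)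
  define A where "A = Pair t -` K"
  have A_eq: "A = snd ` (K \<inter> {z. fst z = t})" by (force simp: A_def)
  have "compact (K \<inter> {z. fst z = t})"
    by (intro compact_Int_closed cp closed_Collect_eq continuous_intros)
  then have cA: "compact A"
    unfolding A_eq by (intro compact_continuous_image continuous_intros)
  have "n0 \<in> A" using n0 interior_subset by (auto simp: A_def)
  then have "A \<noteq> {}" by blast
  obtain p where p: "p \<in> A" "\<And>y. y \<in> A \<Longrightarrow> y \<le> p"
    using compact_attains_sup[OF cA \<open>A \<noteq> {}\<close>] by blast
  obtain q where q: "q \<in> A" "\<And>y. y \<in> A \<Longrightarrow> q \<le> y"
    using compact_attains_inf[OF cA \<open>A \<noteq> {}\<close>] by blast
  obtain e where "0 < e" "(t, n0 + e) \<in> K" "(t, n0 - e) \<in> K"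
    using interior_vertical_nhd[OF n0] .
  then have n0_pq: "q < n0" "n0 < p"
    using p(2)[of "n0 + e"] q(2)[of "n0 - e"] by (auto simp: A_def)
  have P: "(t, p) \<in> K" and Q: "(t, q) \<in> K" using p q by (auto simp: A_def)
  have P': "(t, p) \<notin> interior K"
  proof
    assume "(t, p) \<in> interior K"
    then obtain e where "0 < e" "(t, p + e) \<in> K" using interior_vertical_nhd by blast
    then show False using p(2)[of "p + e"] by (auto simp: A_def)
  qed
  have Q': "(t, q) \<notin> interior K"
  proof
    assume "(t, q) \<in> interior K"
    then obtain e where "0 < e" "(t, q - e) \<in> K" using interior_vertical_nhd by blast
    then show False using q(2)[of "q - e"] by (auto simp: A_def)
  qed
  have mid: "(t, (p + q) / 2) \<in> interior K"
    using vertical_interior[OF n0 P, of "(p + q) / 2"] vertical_interior[OF n0 Q, of "(p + q) / 2"] n0_pq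
    by (cases "n0 \<le> (p + q) / 2") auto
  have "\<exists>\<alpha>. \<forall>s y. (s, y) \<in> K \<longrightarrow> y \<le> p + \<alpha> * (s - t)"
  proof -
    obtain a b where ab: "\<And>s y. (s, y) \<in> K \<Longrightarrow> a * (s - t) + b * (y - p) \<le> 0"
        "\<And>s y. (s, y) \<in> interior K \<Longrightarrow> a * (s - t) + b * (y - p) < 0"
      using supporting_line[OF P P'] by blast
    \<comment> \<open>The interior point lies below the upper end on the same vertical, so strict
      support forces \<open>b > 0\<close> and the supporting line is a graph.\<close>
    have "b * (n0 - p) < 0" using ab(2)[OF n0] by simp
    then have b: "b > 0" using n0_pq by (simp add: mult_less_0_iff)
    have "y \<le> p + (- a / b) * (s - t)" if "(s, y) \<in> K" for s y
      using ab(1)[OF that] b by (simp add: field_simps)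
    then show ?thesis by blast
  qed
  then obtain \<alpha> where \<alpha>: "\<And>s y. (s, y) \<in> K \<Longrightarrow> y \<le> p + \<alpha> * (s - t)" by blast
  have "\<exists>\<beta>. \<forall>s y. (s, y) \<in> K \<longrightarrow> q + \<beta> * (s - t) \<le> y"
  proof -
    obtain a b where ab: "\<And>s y. (s, y) \<in> K \<Longrightarrow> a * (s - t) + b * (y - q) \<le> 0"
        "\<And>s y. (s, y) \<in> interior K \<Longrightarrow> a * (s - t) + b * (y - q) < 0"
      using supporting_line[OF Q Q'] by blast
    have "b * (n0 - q) < 0" using ab(2)[OF n0] by simp
    then have b: "b < 0" using n0_pq by (simp add: mult_less_0_iff)
    have "q + (- a / b) * (s - t) \<le> y" if "(s, y) \<in> K" for s y
      using ab(1)[OF that] b by (simp add: field_simps)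
    then show ?thesis by blast
  qed
  then obtain \<beta> where \<beta>: "\<And>s y. (s, y) \<in> K \<Longrightarrow> q + \<beta> * (s - t) \<le> y" by blast
  show ?thesis
  proof (cases "t = 0")
    case False
    \<comment> \<open>Testing the two lines at the reflected chord ends gives
      \<open>2 * t * \<alpha> \<le> p + q \<le> 2 * t * \<beta>\<close>.\<close>
    have "- q \<le> p + \<alpha> * (- t - t)" "q + \<beta> * (- t - t) \<le> - p"
      using \<alpha>[OF sym[OF Q]] \<beta>[OF sym[OF P]] by auto
    then have "\<alpha> * (2 * t) \<le> \<beta> * (2 * t)" by (simp add: algebra_simps)
    then have "\<alpha> \<le> \<beta>" using False assms(1) by simp
    then have "chord K t p q \<alpha> \<beta>"
      using \<alpha> \<beta> P Q n0_pq assms(1) mid p q by unfold_locales (auto simp: A_def)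
    then show ?thesis by blast
  next
    case True
    \<comment> \<open>For \<open>t = 0\<close> the slopes found need not be ordered, but the central
      chord is symmetric, so reflecting the upper supporting line gives a lower one with the same
      slope.\<close>
    have "- q \<le> p" "q \<le> - p" using p(2)[of "- q"] q(2)[of "- p"] sym[OF P] sym[OF Q] True
      by (auto simp: A_def)
    then have "q = - p" by simp
    then have "q + \<alpha> * (s - t) \<le> y" if "(s, y) \<in> K" for s y
      using \<alpha>[OF sym[OF that]] True by simp
    then have "chord K t p q \<alpha> \<alpha>"
      using \<alpha> P Q n0_pq assms(1) mid p q by unfold_locales (auto simp: A_def)
    then show ?thesis by blast
  qed
qed

section \<open>Areas of the cap and of the middle strip\<close>

lemma emeasure_strip:
  fixes s0 s1 c k d :: real
  assumes "s0 \<le> s1" "0 \<le> d"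
  shows "emeasure lborel {(s, y). s0 \<le> s \<and> s \<le> s1 \<and> c + k * s \<le> y \<and> y \<le> c + k * s + d}
    = ennreal ((s1 - s0) * d)" (is "emeasure _ ?A = _")
proof -
  have cl: "closed ?A"
    unfolding case_prod_unfold by (intro closed_Collect_conj closed_Collect_le continuous_intros)
  then have "?A \<in> sets (lborel \<Otimes>\<^sub>M lborel)" unfolding lborel_prod by simp
  then have "emeasure lborel ?A = (\<integral>\<^sup>+s. emeasure lborel (Pair s -` ?A) \<partial>lborel)"
    using lborel.emeasure_pair_measure_alt[of ?A "lborel :: real measure"] by (simp add: lborel_prod)
  also have "\<dots> = (\<integral>\<^sup>+s. ennreal d * indicator {s0..s1} s \<partial>lborel)"
  proof (rule nn_integral_cong)
    fix s
    \<comment> \<open>Over \<open>{s0..s1}\<close> every vertical slice has length \<open>d\<close>,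
      whatever the slope \<open>k\<close>: the parallelogram is a sheared rectangle.\<close>
    have "Pair s -` ?A = (if s \<in> {s0..s1} then {c + k * s .. c + k * s + d} else {})" by auto
    then show "emeasure lborel (Pair s -` ?A) = ennreal d * indicator {s0..s1} s"
      using assms by (simp add: indicator_def)
  qed
  also have "\<dots> = ennreal ((s1 - s0) * d)"
    using assms by (simp add: nn_integral_cmult_indicator ennreal_mult mult.commute)
  finally show ?thesis .
qed

context chord
begin

text \<open>Lying between the two slopes, \<open>g\<close> keeps the cap between parallel lines;
  dominating both in absolute value, it controls the length of the middle arcs.\<close>

lemma steepest_slope:
  obtains g where "\<alpha> \<le> g" "g \<le> \<beta>" "\<bar>\<alpha>\<bar> \<le> \<bar>g\<bar>" "\<bar>\<beta>\<bar> \<le> \<bar>g\<bar>"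
  using slopes that[of \<alpha>] that[of \<beta>] by linarith

text \<open>The supporting line at the exit point is written in the sheared coordinates
  \<open>s - t\<close> and \<open>y - (p + q) / 2 - g * (s - t)\<close>.\<close>

lemma exit_point:
  obtains x b where "0 < x" "(t + x, (p + q) / 2 + g * x) \<in> K"
    "\<And>s y. (s, y) \<in> K \<Longrightarrow> (s - t) + b * (y - (p + q) / 2 - g * (s - t)) \<le> x"
proof -
  define n where "n = (p + q) / 2"
  obtain B where B: "\<And>z. z \<in> K \<Longrightarrow> norm z \<le> B" "0 < B"
    using compact_imp_bounded[OF cp] bounded_pos by metis
  \<comment> \<open>Far enough for the first coordinate to exceed the norm bound, so the segment
    along the ray must meet the frontier.\<close>
  define X where "X = B + 1"
  have far: "(t + X, n + g * X) \<notin> K"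
  proof
    assume "(t + X, n + g * X) \<in> K"
    then have "\<bar>t + X\<bar> \<le> B" using B(1) norm_fst_le[of "t + X" "n + g * X"] by fastforce
    then show False using t0 B(2) by (simp add: X_def)
  qed
  have nint: "(t, n) \<in> interior K" using mid_int by (simp add: n_def)
  then have nK: "(t, n) \<in> K" using interior_subset by blast
  let ?S = "closed_segment (t, n) (t + X, n + g * X)"
  have "?S \<inter> frontier K \<noteq> {}"
    using far nK by (intro connected_Int_frontier connected_segment) auto
  then obtain m where m: "m \<in> ?S" "m \<in> frontier K" by blast
  then obtain u where u: "0 \<le> u" "u \<le> 1" "m = (1 - u) *\<^sub>R (t, n) + u *\<^sub>R (t + X, n + g * X)"
    by (auto simp: in_segment)
  define x where "x = u * X"
  have m_eq: "m = (t + x, n + g * x)" by (simp add: u(3) x_def algebra_simps)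
  have x0: "0 \<le> x" using u(1) B(2) by (simp add: x_def X_def)
  have mK: "(t + x, n + g * x) \<in> K" using frontier_in_K m(2) m_eq by simp
  have mI: "(t + x, n + g * x) \<notin> interior K" using m(2) m_eq by (simp add: frontier_def)
  obtain a b where ab: "\<And>s y. (s, y) \<in> K \<Longrightarrow> a * (s - (t + x)) + b * (y - (n + g * x)) \<le> 0"
      "\<And>s y. (s, y) \<in> interior K \<Longrightarrow> a * (s - (t + x)) + b * (y - (n + g * x)) < 0"
    using supporting_line[OF mK mI] by blast
  \<comment> \<open>Strict support at the midpoint of the chord shows both that the exit point is
    not the midpoint and that the supporting line crosses the ray. Dividing by
    \<open>a + b * g\<close> then normalises the coefficient of \<open>s - t\<close> to 1.\<close>
  have "0 < (a + b * g) * x" using ab(2)[OF nint] by (simp add: algebra_simps)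
  then have pos: "0 < x" "0 < a + b * g" using x0 by (auto simp: zero_less_mult_iff)
  show thesis
  proof (rule that[of x "b / (a + b * g)"])
    fix s y assume "(s, y) \<in> K"
    then have "(a + b * g) * (s - t) + b * (y - n - g * (s - t)) \<le> (a + b * g) * x"
      using ab(1)[of s y] by (simp add: algebra_simps)
    then show "(s - t) + b / (a + b * g) * (y - (p + q) / 2 - g * (s - t)) \<le> x"
      using pos by (simp add: field_simps flip: n_def)
  qed (use pos mK in \<open>auto simp: n_def\<close>)
qed

lemma between_parallels:
  assumes "\<alpha> \<le> g" "g \<le> \<beta>" "(s, y) \<in> K" "t \<le> s"
  shows "q + g * (s - t) \<le> y" "y \<le> p + g * (s - t)"
proof -
  have "\<alpha> * (s - t) \<le> g * (s - t)" "g * (s - t) \<le> \<beta> * (s - t)"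
    using assms by (auto intro: mult_right_mono)
  then show "q + g * (s - t) \<le> y" "y \<le> p + g * (s - t)"
    using upper_support[OF assms(3)] lower_support[OF assms(3)] by linarith+
qed

lemma cap_area:
  assumes g: "\<alpha> \<le> g" "g \<le> \<beta>"
    and M: "(t + x, (p + q) / 2 + g * x) \<in> K"
    and support: "\<And>s y. (s, y) \<in> K \<Longrightarrow> (s - t) + b * (y - (p + q) / 2 - g * (s - t)) \<le> x"
  shows "measure lebesgue (K \<inter> {z. t \<le> fst z}) \<le> x * (p - q)"
proof -
  define n where "n = (p + q) / 2"
  have n2: "2 * n = p + q" by (simp add: n_def)
  define C where "C = K \<inter> {z. t \<le> fst z}"
  \<comment> \<open>Twice the exit point, so that \<open>r\<close> is the point reflection in the
    exit point.\<close>
  define M2 where "M2 = (2 * t + 2 * x, p + q + 2 * g * x)"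
  define r where "r z = (-1) *\<^sub>R z + M2" for z
  define S where "S = {(s, y). t \<le> s \<and> s \<le> t + 2 * x \<and> (q - g * t) + g * s \<le> y
      \<and> y \<le> (q - g * t) + g * s + (p - q)}"
  have "compact C" unfolding C_def
    by (intro compact_Int_closed cp closed_Collect_le continuous_intros)
  then have Cm: "C \<in> lmeasurable" by (rule lmeasurable_compact)
  have "compact (r ` C)" unfolding r_def
    by (intro compact_continuous_image continuous_intros \<open>compact C\<close>)
  then have rCm: "r ` C \<in> lmeasurable" by (rule lmeasurable_compact)
  have "x \<ge> 0"
    using support[OF upper_mem] support[OF lower_mem] qp by (simp add: algebra_simps add_divide_distrib)
  have Cin: "(s, y) \<in> S" if "(s, y) \<in> C" for s y
  proof -
    have K: "(s, y) \<in> K" "t \<le> s" using that by (auto simp: C_def)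
    note bd = between_parallels[OF g K]
    define y' where "y' = y - n - g * (s - t)"
    have y': "\<bar>y'\<bar> \<le> (p - q) / 2" using bd by (auto simp: y'_def n_def abs_le_iff field_simps)
    have 1: "(s - t) + b * y' \<le> x" using support[OF K(1)] by (simp add: y'_def n_def)
    \<comment> \<open>The support inequality at the two chord ends bounds
      \<open>\<bar>b\<bar> * ((p - q) / 2)\<close> by \<open>x\<close>. Hence the tilt of the
      supporting line lets \<open>s - t\<close> exceed \<open>x\<close> by at most another
      \<open>x\<close>.\<close>
    have "b * ((p - q) / 2) \<le> x" "- (b * ((p - q) / 2)) \<le> x"
      using support[OF upper_mem] support[OF lower_mem] by (simp_all add: field_simps)
    then have "\<bar>b\<bar> * ((p - q) / 2) \<le> x" by (cases "0 \<le> b") auto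
    moreover have "\<bar>b * y'\<bar> \<le> \<bar>b\<bar> * ((p - q) / 2)"
      unfolding abs_mult using y' by (intro mult_left_mono) auto
    ultimately have "s \<le> t + 2 * x" using 1 by linarith
    then show ?thesis using bd K(2) by (simp add: S_def algebra_simps)
  qed
  then have CS: "C \<subseteq> S" by auto
  \<comment> \<open>\<open>S\<close> is symmetric about the exit point, so it contains the reflected
    cap too.\<close>
  have rCS: "r ` C \<subseteq> S"
  proof -
    have "r (s, y) \<in> S" if "(s, y) \<in> C" for s y
      using Cin[OF that] by (simp add: S_def r_def M2_def algebra_simps)
    then show ?thesis by auto
  qed
  \<comment> \<open>Reflection reverses the support inequality, so common points satisfy it with
    equality.\<close>
  have "C \<inter> r ` C \<subseteq> {z. (1 - b * g, b) \<bullet> z = x + t + b * n - b * g * t}"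
  proof -
    have "(s, y) \<in> {z. (1 - b * g, b) \<bullet> z = x + t + b * n - b * g * t}"
      if "(s, y) \<in> C" "(s', y') \<in> C" "(s, y) = r (s', y')" for s y s' y'
    proof -
      have "(s - t) + b * (y - n - g * (s - t)) \<le> x" "(s' - t) + b * (y' - n - g * (s' - t)) \<le> x"
        using support that by (auto simp: C_def n_def)
      moreover have "s' = 2 * t + 2 * x - s" "y' = 2 * n + 2 * g * x - y"
        using that(3) by (auto simp: r_def M2_def n2)
      ultimately show ?thesis by (simp add: algebra_simps)
    qed
    then show ?thesis by auto
  qed
  moreover have "(1 - b * g, b) \<noteq> 0" by (auto simp: zero_prod_def)
  ultimately have "negligible (C \<inter> r ` C)"
    using negligible_hyperplane negligible_subset by blast
  then have "measure lebesgue (C \<union> r ` C) = measure lebesgue C + measure lebesgue (r ` C)"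
    using measure_Un3[OF Cm rCm] negligible_imp_measure0 by simp
  also have "measure lebesgue (r ` C) = measure lebesgue C"
    unfolding r_def using measure_lebesgue_affine[of "-1" M2 C] by simp
  finally have "2 * measure lebesgue C = measure lebesgue (C \<union> r ` C)" by simp
  also have "\<dots> \<le> measure lebesgue S"
  proof (rule measure_mono_fmeasurable)
    have "closed S" unfolding S_def case_prod_unfold
      by (intro closed_Collect_conj closed_Collect_le continuous_intros)
    then have "S \<in> sets borel" by simp
    moreover have e: "emeasure lborel S = ennreal (2 * x * (p - q))"
      using emeasure_strip[of t "t + 2 * x" "p - q" "q - g * t" g] qp \<open>x \<ge> 0\<close> by (simp add: S_def)
    ultimately show "S \<in> lmeasurable" by (intro fmeasurableI) auto
  qed (use CS rCS Cm rCm in auto)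
  also have "\<dots> = 2 * x * (p - q)"
  proof -
    have "closed S" unfolding S_def case_prod_unfold
      by (intro closed_Collect_conj closed_Collect_le continuous_intros)
    then have "measure lebesgue S = measure lborel S" by simp
    moreover have "emeasure lborel S = ennreal (2 * x * (p - q))"
      using emeasure_strip[of t "t + 2 * x" "p - q" "q - g * t" g] qp \<open>x \<ge> 0\<close> by (simp add: S_def)
    ultimately show ?thesis using qp \<open>x \<ge> 0\<close> by (simp add: measure_eq_emeasure_eq_ennreal)
  qed
  finally show ?thesis by (simp add: C_def)
qed

text \<open>The chord and its reflection are the vertical sides of a parallelogram inside
  \<open>K\<close>, whose median passes through the centre with slope \<open>n / t\<close>. For
  \<open>t = 0\<close> the left side vanishes.\<close>

lemma middle_area: "2 * t * (p - q) \<le> measure lebesgue (K \<inter> {z. \<bar>fst z\<bar> \<le> t})"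
proof (cases "t = 0")
  case False
  then have t: "0 < t" using t0 by simp
  define n where "n = (p + q) / 2"
  define d where "d = (p - q) / 2"
  define S where "S = {(s, y). - t \<le> s \<and> s \<le> t \<and> - d + (n / t) * s \<le> y
      \<and> y \<le> - d + (n / t) * s + 2 * d}"
  have d: "0 < d" using qp by (simp add: d_def)
  have pq: "p = n + d" "q = n - d" by (simp_all add: n_def d_def field_simps)
  have "S \<subseteq> K \<inter> {z. \<bar>fst z\<bar> \<le> t}"
  proof -
    have "(s, y) \<in> K" if "(s, y) \<in> S" for s y
    proof -
      \<comment> \<open>\<open>l\<close> is the horizontal position between the two chords;
        \<open>k\<close> below is the vertical position between the lower and the upper
        side.\<close>
      define l where "l = (s + t) / (2 * t)"
      have sy: "- t \<le> s" "s \<le> t" "- d + (n / t) * s \<le> y" "y \<le> - d + (n / t) * s + 2 * d"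
        using that by (auto simp: S_def)
      have l: "0 \<le> l" "l \<le> 1" using sy t by (auto simp: l_def field_simps)
      have s: "(1 - l) * (- t) + l * t = s" using t by (simp add: l_def field_simps)
      have ns: "(2 * l - 1) * n = (n / t) * s" using t by (simp add: l_def field_simps)
      have up_eq: "(1 - l) * (- q) + l * p = (n / t) * s + d"
        and lo_eq: "(1 - l) * (- p) + l * q = (n / t) * s - d"
        unfolding ns[symmetric] pq by (simp_all add: algebra_simps)
      have up: "(s, (n / t) * s + d) \<in> K" and lo: "(s, (n / t) * s - d) \<in> K"
        using combination[OF sym[OF lower_mem] upper_mem l] combination[OF sym[OF upper_mem] lower_mem l] s
        unfolding up_eq lo_eq by simp_all
      have conv: "(1 - k) * (v - d) + k * (v + d) = v - d + k * (2 * d)" for k v :: real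
        by (simp add: algebra_simps)
      define k where "k = (y - ((n / t) * s - d)) / (2 * d)"
      have "0 \<le> k" "k \<le> 1" using sy d by (auto simp: k_def field_simps)
      from combination[OF lo up this]
      have "((1 - k) * s + k * s, (1 - k) * ((n / t) * s - d) + k * ((n / t) * s + d)) \<in> K" .
      moreover have "(1 - k) * s + k * s = s" by (simp add: algebra_simps)
      moreover have "(1 - k) * ((n / t) * s - d) + k * ((n / t) * s + d) = (n / t) * s - d + k * (2 * d)"
        unfolding conv ..
      moreover have "k * (2 * d) = y - ((n / t) * s - d)" using d by (simp add: k_def)
      ultimately show ?thesis by simp
    qed
    moreover have "\<bar>s\<bar> \<le> t" if "(s, y) \<in> S" for s y using that by (auto simp: S_def)
    ultimately show ?thesis by auto
  qed
  moreover have "closed S" unfolding S_def case_prod_unfold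
    by (intro closed_Collect_conj closed_Collect_le continuous_intros)
  moreover have "compact (K \<inter> {z. \<bar>fst z\<bar> \<le> t})"
    by (intro compact_Int_closed cp closed_Collect_le continuous_intros)
  ultimately have "measure lebesgue S \<le> measure lebesgue (K \<inter> {z. \<bar>fst z\<bar> \<le> t})"
    by (intro measure_mono_fmeasurable lmeasurable_compact) auto
  moreover have "emeasure lborel S = ennreal (2 * t * (p - q))"
    using emeasure_strip[of "- t" t "2 * d" "- d" "n / t"] t d by (simp add: S_def d_def)
  then have "measure lborel S = 2 * t * (p - q)"
    using t qp by (simp add: measure_eq_emeasure_eq_ennreal)
  ultimately show ?thesis using \<open>closed S\<close> by simp
qed simp

text \<open>Let \<open>n\<close> and \<open>d\<close> be the midpoint and half-length of the chord.
  The functional \<open>(s - t) + g * (y - n)\<close> equals \<open>g * \<sigma> * d\<close> at a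
  chord end and \<open>x * (1 + g\<^sup>2)\<close> at the exit point. Take the point of the joining
  segment where it equals \<open>w\<close> and walk away from the ray, orthogonally to
  \<open>(1, g)\<close>, until the frontier is met.\<close>

lemma cap_frontier_point:
  assumes \<sigma>: "\<sigma> = 1 \<or> \<sigma> = - 1" and x: "0 < x"
    and M: "(t + x, (p + q) / 2 + g * x) \<in> K"
    and w: "g * \<sigma> * ((p - q) / 2) < w" "w < x * (1 + g\<^sup>2)"
  obtains s y where "(s, y) \<in> frontier K" "t < s"
    "0 < \<sigma> * (y - (p + q) / 2 - g * (s - t))" "(s - t) + g * (y - (p + q) / 2) = w"
proof -
  define n where "n = (p + q) / 2"
  define d where "d = (p - q) / 2"
  have d: "0 < d" using qp by (simp add: d_def)
  have \<sigma>2: "\<sigma> * \<sigma> = 1" "\<And>z. \<sigma> * (\<sigma> * z) = z" using \<sigma> by auto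
  define D where "D = x * (1 + g\<^sup>2) - g * \<sigma> * d"
  \<comment> \<open>The fraction of the segment at which the functional, affine with total increment
    \<open>D\<close>, takes the value \<open>w\<close>.\<close>
  define l where "l = (w - g * \<sigma> * d) / D"
  have D: "0 < D" "w - g * \<sigma> * d < D" "0 < w - g * \<sigma> * d" using w by (auto simp: D_def d_def)
  have l: "0 < l" "l < 1" using D by (auto simp: l_def)
  have lD: "l * D = w - g * \<sigma> * d" using D by (simp add: l_def)
  have "(t, n + \<sigma> * d) \<in> K"
    using \<sigma> upper_mem lower_mem by (auto simp: n_def d_def field_simps)
  from combination[OF this, of _ _ l] M l
  have z00: "((1 - l) * t + l * (t + x), (1 - l) * (n + \<sigma> * d) + l * (n + g * x)) \<in> K"
    by (simp add: n_def)
  define s0 where "s0 = t + l * x"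
  define y0 where "y0 = n + (1 - l) * \<sigma> * d + l * g * x"
  have z0: "(s0, y0) \<in> K"
    using z00 by (simp add: s0_def y0_def algebra_simps)
  have Q0: "(s0 - t) + g * (y0 - n) = w"
    using lD by (simp add: s0_def y0_def D_def algebra_simps power2_eq_square)
  obtain B where B: "\<And>z. z \<in> K \<Longrightarrow> norm z \<le> B" "0 < B"
    using compact_imp_bounded[OF cp] bounded_pos by metis
  \<comment> \<open>Large enough for the second coordinate to exceed the norm bound in absolute
    value. The direction \<open>(- \<sigma> * g, \<sigma>)\<close> of the walk keeps the functional
    constant.\<close>
  define T where "T = B + \<bar>y0\<bar> + 1"
  have far: "(s0 - T * \<sigma> * g, y0 + \<sigma> * T) \<notin> K"
  proof
    assume "(s0 - T * \<sigma> * g, y0 + \<sigma> * T) \<in> K"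
    then have "\<bar>y0 + \<sigma> * T\<bar> \<le> B"
      using B(1) norm_snd_le[of "y0 + \<sigma> * T" "s0 - T * \<sigma> * g"] by fastforce
    then show False using \<sigma> B(2) by (auto simp: T_def)
  qed
  let ?S = "closed_segment (s0, y0) (s0 - T * \<sigma> * g, y0 + \<sigma> * T)"
  have "?S \<inter> frontier K \<noteq> {}"
    using far z0 by (intro connected_Int_frontier connected_segment) auto
  then obtain m where m: "m \<in> ?S" "m \<in> frontier K" by blast
  then obtain u where u: "0 \<le> u" "u \<le> 1"
      "m = (1 - u) *\<^sub>R (s0, y0) + u *\<^sub>R (s0 - T * \<sigma> * g, y0 + \<sigma> * T)"
    by (auto simp: in_segment)
  define \<tau> where "\<tau> = u * T"
  have \<tau>: "0 \<le> \<tau>" using u(1) B(2) by (simp add: \<tau>_def T_def)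
  define s where "s = s0 - \<tau> * \<sigma> * g"
  define y where "y = y0 + \<sigma> * \<tau>"
  have m_eq: "m = (s, y)" by (simp add: u(3) \<tau>_def s_def y_def algebra_simps)
  have mK: "(s, y) \<in> K" using frontier_in_K m(2) m_eq by simp
  \<comment> \<open>If the walk returned to the line \<open>s = t\<close>, convexity would give a
    chord point with functional value \<open>w\<close>. Returning requires
    \<open>0 < \<sigma> * g\<close>, and then the values on the chord are at most
    \<open>g * \<sigma> * d < w\<close>.\<close>
  have "t < s"
  proof (rule ccontr)
    assume "\<not> t < s"
    then have le: "l * x \<le> \<tau> * (\<sigma> * g)" by (simp add: s_def s0_def)
    have lx: "0 < l * x" using l x by simp
    with le have "0 < \<tau> * (\<sigma> * g)" by linarith
    then have pos: "0 < \<tau>" "0 < \<sigma> * g" using \<tau> by (auto simp: zero_less_mult_iff)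
    define c where "c = \<tau> * (\<sigma> * g)"
    define k where "k = l * x / c"
    have k: "0 \<le> k" "k \<le> 1" and kk: "k * c = l * x"
      using lx le by (auto simp: k_def c_def[symmetric])
    define y1 where "y1 = (1 - k) * y0 + k * y"
    have "(1 - k) * s0 + k * s = s0 - k * c" by (simp add: s_def c_def algebra_simps)
    also have "\<dots> = t" by (simp add: kk s0_def)
    finally have "(t, y1) \<in> K" using combination[OF z0 mK k] by (simp add: y1_def)
    then have "\<bar>y1 - n\<bar> \<le> d" using ends[of y1] by (auto simp: n_def d_def abs_le_iff field_simps)
    then have "\<sigma> * (y1 - n) \<le> d" using \<sigma> by auto
    then have "(\<sigma> * g) * (\<sigma> * (y1 - n)) \<le> (\<sigma> * g) * d" using pos by (intro mult_left_mono) auto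
    also have "(\<sigma> * g) * (\<sigma> * (y1 - n)) = (\<sigma> * \<sigma>) * (g * (y1 - n))" by (simp only: ac_simps)
    finally have 1: "g * (y1 - n) \<le> g * \<sigma> * d" by (simp add: \<sigma>2(1) ac_simps)
    have "y1 - y0 = k * \<sigma> * \<tau>" by (simp add: y1_def y_def algebra_simps)
    then have "g * (y1 - n) = g * (y0 - n) + k * c" by (simp add: c_def algebra_simps)
    also have "\<dots> = w" using Q0 kk by (simp add: s0_def)
    finally show False using 1 w by (simp add: d_def)
  qed
  moreover have "0 < \<sigma> * (y - n - g * (s - t))"
  proof -
    \<comment> \<open>Height over the ray: the starting height \<open>(1 - l) * d\<close> plus a
      gain of \<open>1 + g\<^sup>2\<close> per unit of \<open>\<tau>\<close>.\<close>
    have "\<sigma> * (y - n - g * (s - t)) = \<sigma> * \<sigma> * ((1 - l) * d) + \<sigma> * \<sigma> * (\<tau> * (1 + g\<^sup>2))"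
      by (simp add: y_def y0_def s_def s0_def algebra_simps power2_eq_square)
    also have "\<dots> = (1 - l) * d + \<tau> * (1 + g\<^sup>2)" by (simp only: \<sigma>2)
    finally show ?thesis using l d \<tau> by (simp add: add_pos_nonneg)
  qed
  moreover have "(s - t) + g * (y - n) = w"
    using Q0 by (simp add: s_def y_def algebra_simps)
  ultimately show thesis using that m(2) m_eq by (simp add: n_def)
qed

end

section \<open>Lengths of the boundary arcs\<close>

lemma open_Collect_less_on:
  fixes f g :: "'a::topological_space \<Rightarrow> real"
  assumes "open S" "continuous_on S f" "continuous_on S g"
  shows "open {x \<in> S. f x < g x}"
  using open_Collect_less_Int[OF assms(2,3)] assms(1) by (metis open_Int)

lemma borel_Collect_less_on:
  fixes f g :: "real \<Rightarrow> real"
  assumes "continuous_on {a..b} f" "continuous_on {a..b} g"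
  shows "{x \<in> {a..b}. f x < g x} \<in> sets borel"
proof -
  have "closed {x \<in> {a..b}. g x \<le> f x}"
    using assms by (intro continuous_on_closed_Collect_le) auto
  moreover have "{x \<in> {a..b}. f x < g x} = {a..b} - {x \<in> {a..b}. g x \<le> f x}" by auto
  ultimately show ?thesis by auto
qed

lemma dist_le_slope:
  fixes g s1 s2 y1 y2 :: real
  assumes "\<bar>y1 - y2\<bar> \<le> \<bar>g\<bar> * \<bar>s1 - s2\<bar>"
  shows "dist (s1, y1) (s2, y2) \<le> sqrt (1 + g\<^sup>2) * \<bar>s1 - s2\<bar>"
proof -
  have "(y1 - y2)\<^sup>2 \<le> (g * (s1 - s2))\<^sup>2"
    using assms by (simp only: abs_le_square_iff[symmetric] abs_mult)
  then have "(y1 - y2)\<^sup>2 \<le> g\<^sup>2 * (s1 - s2)\<^sup>2" by (simp only: power_mult_distrib)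
  then have "dist (s1, y1) (s2, y2) \<le> sqrt ((1 + g\<^sup>2) * (s1 - s2)\<^sup>2)"
    by (simp add: dist_Pair_Pair dist_real_def distrib_right)
  then show ?thesis by (simp add: real_sqrt_mult)
qed

text \<open>Reflection turns the estimates for the right cap and the upper arc into those for the
  left cap and the lower arc.\<close>

lemma arc_length_parametrization_minus:
  fixes \<gamma> :: "real \<Rightarrow> 'a::real_normed_vector"
  assumes "arc_length_parametrization \<gamma> L C"
  shows "arc_length_parametrization (\<lambda>r. - \<gamma> r) L (uminus ` C)"
proof -
  have "curve_length (\<lambda>r. - \<gamma> r) a b = curve_length \<gamma> a b" for a b
    by (simp add: curve_length_def dist_minus)
  then show ?thesis
    using assms by (auto simp: arc_length_parametrization_def inj_on_def intro!: continuous_intros)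
qed

lemma (in sym_planar_body) frontier_minus: "uminus ` frontier K = frontier K"
proof -
  have "uminus ` K = K"
    using sym by (force simp: image_iff)
  moreover have "uminus ` (K - interior K) = uminus ` K - uminus ` interior K"
    by (intro image_set_diff) auto
  ultimately show ?thesis
    using interior_negations[of K] closed_K by (simp add: frontier_def)
qed

context chord
begin

text \<open>Projection onto the direction \<open>(1, g)\<close> shortens lengths, and the part of the cap boundary above
  (\<open>\<sigma> = 1\<close>) or below (\<open>\<sigma> = - 1\<close>) the ray to the exit point projects onto the whole interval between
  the projections of the end of the chord and of the exit point.\<close>

lemma cap_length_half:
  assumes \<sigma>: "\<sigma> = 1 \<or> \<sigma> = - 1" and x: "0 < x" "(t + x, (p + q) / 2 + g * x) \<in> K"
    and \<gamma>: "arc_length_parametrization \<gamma> L (frontier K)"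
  defines "E \<equiv> {r \<in> {0<..<L}. t < fst (\<gamma> r) \<and> 0 < \<sigma> * (snd (\<gamma> r) - (p + q) / 2 - g * (fst (\<gamma> r) - t))}"
  shows "open E" and "x * sqrt (1 + g\<^sup>2) - g * \<sigma> * ((p - q) / 2) / sqrt (1 + g\<^sup>2) \<le> measure lborel E"
proof -
  define n where "n = (p + q) / 2"
  define d where "d = (p - q) / 2"
  define \<phi> where "\<phi> = sqrt (1 + g\<^sup>2)"
  have \<phi>2: "\<phi> * \<phi> = 1 + g\<^sup>2" and \<phi>: "0 < \<phi>" by (auto simp: \<phi>_def add_pos_nonneg)
  have cont: "continuous_on {0..L} \<gamma>" and im: "\<gamma> ` {0..L} = frontier K" and loop: "\<gamma> L = \<gamma> 0"
    using \<gamma> by (auto simp: arc_length_parametrization_def)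
  have short: "dist (\<gamma> a) (\<gamma> b) \<le> \<bar>a - b\<bar>" if "a \<in> {0..L}" "b \<in> {0..L}" for a b
    using arc_length_parametrization_short[OF \<gamma> that] .
  have cont': "continuous_on {0<..<L} \<gamma>" using cont by (rule continuous_on_subset) auto
  have "E = {r \<in> {0<..<L}. t < fst (\<gamma> r)}
      \<inter> {r \<in> {0<..<L}. 0 < \<sigma> * (snd (\<gamma> r) - (p + q) / 2 - g * (fst (\<gamma> r) - t))}" by (auto simp: E_def)
  moreover have "open {r \<in> {0<..<L}. t < fst (\<gamma> r)}"
    by (intro open_Collect_less_on continuous_intros cont' open_greaterThanLessThan)
  moreover have "open {r \<in> {0<..<L}. 0 < \<sigma> * (snd (\<gamma> r) - (p + q) / 2 - g * (fst (\<gamma> r) - t))}"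
    by (intro open_Collect_less_on continuous_intros cont' open_greaterThanLessThan)
  ultimately show op: "open E" by (simp add: open_Int)
  \<comment> \<open>The component of the curve along the unit vector in direction
    \<open>(1, g)\<close>, measured from the midpoint of the chord. Cauchy-Schwarz makes it short in
    the arc length parameter.\<close>
  define f where "f r = ((fst (\<gamma> r) - t) + g * (snd (\<gamma> r) - n)) / \<phi>" for r
  have f_short: "\<bar>f a - f b\<bar> \<le> \<bar>a - b\<bar>" if "a \<in> {0..L}" "b \<in> {0..L}" for a b
  proof -
    define u v where "u = fst (\<gamma> a) - fst (\<gamma> b)" and "v = snd (\<gamma> a) - snd (\<gamma> b)"
    have "f a - f b = (u + g * v) / \<phi>"
      by (simp add: f_def u_def v_def diff_divide_distrib[symmetric] algebra_simps)
    moreover have "\<bar>u + g * v\<bar> \<le> \<phi> * sqrt (u\<^sup>2 + v\<^sup>2)"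
      using Cauchy_Schwarz_ineq2[of "(1, g)" "(u, v)"] by (simp add: norm_Pair \<phi>_def)
    moreover have "sqrt (u\<^sup>2 + v\<^sup>2) = dist (\<gamma> a) (\<gamma> b)"
      by (simp add: u_def v_def dist_prod_def dist_real_def)
    ultimately have "\<bar>f a - f b\<bar> \<le> dist (\<gamma> a) (\<gamma> b)"
      using \<phi> by (simp add: divide_le_eq abs_divide mult.commute)
    then show ?thesis using short[OF that] by simp
  qed
  \<comment> \<open>Projections of the chord end on the \<open>\<sigma>\<close> side and of the exit
    point.\<close>
  define lo hi where "lo = g * \<sigma> * d / \<phi>" and "hi = x * \<phi>"
  have bE: "bounded E" by (rule bounded_subset[of "{0<..<L}"]) (auto simp: E_def)
  \<comment> \<open>\<open>E\<close> omits the parameters \<open>0\<close> and \<open>L\<close>;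
    they give the same curve point, so the single value \<open>f 0\<close>, a null set, accounts for
    both.\<close>
  have sub: "{lo<..<hi} \<subseteq> f ` E \<union> {f 0}"
  proof
    fix w assume "w \<in> {lo<..<hi}"
    then have w1: "g * \<sigma> * ((p - q) / 2) < w * \<phi>" and "w < x * \<phi>"
      using \<phi> by (auto simp: lo_def hi_def d_def divide_less_eq)
    then have "w * \<phi> < x * \<phi> * \<phi>" using \<phi> by simp
    then have w2: "w * \<phi> < x * (1 + g\<^sup>2)" by (simp add: \<phi>2 mult.assoc)
    obtain s y where sy: "(s, y) \<in> frontier K" "t < s"
        "0 < \<sigma> * (y - (p + q) / 2 - g * (s - t))" "(s - t) + g * (y - (p + q) / 2) = w * \<phi>"
      using cap_frontier_point[OF \<sigma> x w1 w2] .
    then obtain r where r: "r \<in> {0..L}" "\<gamma> r = (s, y)" using im by force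
    have fw: "f r = w" using sy(4) r(2) \<phi> by (simp add: f_def n_def)
    show "w \<in> f ` E \<union> {f 0}"
    proof (cases "r \<in> {0<..<L}")
      case True
      then show ?thesis using fw r sy by (auto simp: E_def intro!: image_eqI[of w f r])
    next
      case False
      then have "r = 0 \<or> r = L" using r(1) by auto
      moreover have "f L = f 0" using loop by (simp add: f_def)
      ultimately show ?thesis using fw by auto
    qed
  qed
  have "continuous_on E \<gamma>" using cont' by (rule continuous_on_subset) (auto simp: E_def)
  then have "continuous_on E f"
    unfolding f_def using \<phi> by (auto intro!: continuous_intros)
  then have fE: "f ` E \<in> sets borel" by (rule borel_continuous_image_open[OF op])
  have "emeasure lborel {lo<..<hi} \<le> emeasure lborel (f ` E \<union> {f 0})"
    using sub fE by (intro emeasure_mono) auto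
  also have "\<dots> \<le> emeasure lborel (f ` E) + emeasure lborel {f 0}"
    using fE by (intro emeasure_subadditive) auto
  also have "\<dots> = emeasure lborel (f ` E)" by simp
  also have "\<dots> \<le> emeasure lborel E"
    by (rule emeasure_lborel_short_image_le[OF op bE]) (auto simp: E_def intro!: f_short)
  also have "\<dots> = ennreal (measure lborel E)"
    using emeasure_bounded_finite[OF bE] by (simp add: emeasure_eq_ennreal_measure)
  finally have le: "emeasure lborel {lo<..<hi} \<le> ennreal (measure lborel E)" .
  have "hi - lo \<le> measure lborel E"
  proof (cases "lo \<le> hi")
    case False
    then have "hi - lo \<le> 0" by simp
    also have "0 \<le> measure lborel E" by simp
    finally show ?thesis .
  qed (use le in simp)
  then show "x * sqrt (1 + g\<^sup>2) - g * \<sigma> * ((p - q) / 2) / sqrt (1 + g\<^sup>2) \<le> measure lborel E"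
    by (simp add: lo_def hi_def \<phi>_def d_def)
qed

text \<open>The parts above and below the ray are disjoint, and the terms with
  \<open>g * \<sigma>\<close> cancel when their bounds are added.\<close>

lemma cap_length:
  assumes x: "0 < x" "(t + x, (p + q) / 2 + g * x) \<in> K"
    and \<gamma>: "arc_length_parametrization \<gamma> L (frontier K)"
  shows "2 * x * sqrt (1 + g\<^sup>2) \<le> measure lborel {r \<in> {0..L}. t < fst (\<gamma> r)}"
proof -
  define E where "E \<sigma> = {r \<in> {0<..<L}. t < fst (\<gamma> r)
      \<and> 0 < \<sigma> * (snd (\<gamma> r) - (p + q) / 2 - g * (fst (\<gamma> r) - t))}" for \<sigma>
  have cont: "continuous_on {0..L} \<gamma>" using \<gamma> by (auto simp: arc_length_parametrization_def)
  have op: "open (E \<sigma>)"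
    and len: "x * sqrt (1 + g\<^sup>2) - g * \<sigma> * ((p - q) / 2) / sqrt (1 + g\<^sup>2) \<le> measure lborel (E \<sigma>)"
    if "\<sigma> = 1 \<or> \<sigma> = - 1" for \<sigma>
    unfolding E_def by (rule cap_length_half[OF that x \<gamma>])+
  have "bounded (E \<sigma>)" for \<sigma> by (rule bounded_subset[of "{0<..<L}"]) (auto simp: E_def)
  then have m: "E 1 \<in> lmeasurable" "E (- 1) \<in> lmeasurable" using op by (auto intro: lmeasurable_open)
  have mb: "E 1 \<in> sets borel" "E (- 1) \<in> sets borel" using op by auto
  have C: "{r \<in> {0..L}. t < fst (\<gamma> r)} \<in> sets borel"
    using cont by (intro borel_Collect_less_on continuous_intros)
  have U: "measure lebesgue (E 1 \<union> E (- 1)) = measure lebesgue (E 1) + measure lebesgue (E (- 1))"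
  proof -
    have "E 1 \<inter> E (- 1) = {}" by (auto simp: E_def)
    then show ?thesis using measure_Un3[OF m] by simp
  qed
  have "measure lebesgue (E 1 \<union> E (- 1)) \<le> measure lebesgue {r \<in> {0..L}. t < fst (\<gamma> r)}"
  proof (rule measure_mono_fmeasurable)
    have "bounded {r \<in> {0..L}. t < fst (\<gamma> r)}" by (rule bounded_subset[of "{0..L}"]) auto
    moreover have "{r \<in> {0..L}. t < fst (\<gamma> r)} \<in> sets lebesgue"
      by (intro sets_completionI_sets) (simp only: C sets_lborel)
    ultimately show "{r \<in> {0..L}. t < fst (\<gamma> r)} \<in> lmeasurable"
      by (rule bounded_set_imp_lmeasurable)
    show "E 1 \<union> E (- 1) \<subseteq> {r \<in> {0..L}. t < fst (\<gamma> r)}" unfolding E_def by fastforce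
    show "E 1 \<union> E (- 1) \<in> sets lebesgue" by (intro sets.Un fmeasurableD m)
  qed
  moreover have "measure lebesgue A = measure lborel A" if "A \<in> sets borel" for A :: "real set"
    using that by simp
  note this[OF C] this[OF mb(1)] this[OF mb(2)]
  ultimately show ?thesis using U len[of 1] len[of "- 1"] by linarith
qed

section \<open>Length of the boundary within the middle strip\<close>

lemma axis_interior:
  assumes t: "0 < t" and "\<bar>s\<bar> < t"
  shows "(s, (p + q) / 2 / t * s) \<in> interior K"
proof -
  define n where "n = (p + q) / 2"
  \<comment> \<open>Position on the segment from \<open>(t, n)\<close> to its reflection; all of it
    except the far end is interior because \<open>(t, n)\<close> is.\<close>
  define l where "l = (t - s) / (2 * t)"
  have l: "0 \<le> l" "l < 1" using assms by (auto simp: l_def field_simps)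
  have nint: "(t, n) \<in> interior K" using mid_int by (simp add: n_def)
  then have "(- t, - n) \<in> K" using sym interior_subset by blast
  from interior_combination[OF nint this l]
  have "((1 - 2 * l) * t, (1 - 2 * l) * n) \<in> interior K" by (simp add: algebra_simps)
  moreover have "1 - 2 * l = s / t" using t by (simp add: l_def field_simps)
  ultimately show ?thesis using t by (simp add: n_def[symmetric] ac_simps)
qed

text \<open>The upper arc is a concave graph. The slope between two of its points is at least that
  from the left one to \<open>(t, p)\<close>, hence at least \<open>\<alpha>\<close>, and at most
  that from \<open>(- t, - q)\<close> to the right one, hence at most
  \<open>\<beta>\<close>.\<close>

lemma upper_arc_slope:
  assumes t: "0 < t" and g: "\<bar>\<alpha>\<bar> \<le> \<bar>g\<bar>" "\<bar>\<beta>\<bar> \<le> \<bar>g\<bar>"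
    and z1: "(s1, y1) \<in> frontier K" "\<bar>s1\<bar> < t" "(p + q) / 2 / t * s1 < y1"
    and z2: "(s2, y2) \<in> frontier K" "\<bar>s2\<bar> < t" "(p + q) / 2 / t * s2 < y2"
  shows "\<bar>y1 - y2\<bar> \<le> \<bar>g\<bar> * \<bar>s1 - s2\<bar>"
proof -
  define n where "n = (p + q) / 2"
  note axis_int = axis_interior[OF t, folded n_def]
  \<comment> \<open>With a higher point of \<open>K\<close> on its vertical, the boundary point
    would lie between it and an interior point of the axis, and so be interior itself.\<close>
  have upper: "y' \<le> y"
    if "(s, y) \<in> frontier K" "\<bar>s\<bar> < t" "n / t * s < y" "(s, y') \<in> K" for s y y'
  proof (rule ccontr)
    assume "\<not> y' \<le> y"
    then have "(s, y) \<in> interior K"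
      using vertical_interior[OF axis_int[OF that(2)] that(4), of y] that(3) by simp
    then show False using that(1) by (simp add: frontier_def)
  qed
  have slope: "\<alpha> * (b - a) \<le> yb - ya \<and> yb - ya \<le> \<beta> * (b - a)"
    if a: "(a, ya) \<in> frontier K" "\<bar>a\<bar> < t" "n / t * a < ya"
      and b: "(b, yb) \<in> frontier K" "\<bar>b\<bar> < t" "n / t * b < yb" and "a < b" for a ya b yb
  proof
    note aK = frontier_in_K[OF a(1)] and bK = frontier_in_K[OF b(1)]
    \<comment> \<open>Weight that places \<open>b\<close> between \<open>a\<close> and
      \<open>t\<close>; the combination lies in \<open>K\<close>, hence not above
      \<open>yb\<close>.\<close>
    define l where "l = (b - a) / (t - a)"
    have l: "0 \<le> l" "l \<le> 1" and lt: "l * (t - a) = b - a"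
      using a(2) b(2) \<open>a < b\<close> by (auto simp: l_def)
    have "(1 - l) * a + l * t = b" using lt by (simp add: algebra_simps)
    then have "(1 - l) * ya + l * p \<le> yb"
      using combination[OF aK upper_mem l] upper[OF b, of "(1 - l) * ya + l * p"] by simp
    moreover have "l * (\<alpha> * (t - a)) \<le> l * (p - ya)"
      using upper_support[OF aK] l by (intro mult_left_mono) (auto simp: algebra_simps)
    moreover have "l * (\<alpha> * (t - a)) = \<alpha> * (b - a)" by (simp only: lt[symmetric] ac_simps)
    ultimately show "\<alpha> * (b - a) \<le> yb - ya" by (simp add: algebra_simps)
    \<comment> \<open>The same to the left: \<open>a\<close> lies between \<open>- t\<close> and
      \<open>b\<close>, and the lower supporting line is applied at the reflected point.\<close>
    define m where "m = (b - a) / (b + t)"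
    have m: "0 \<le> m" "m \<le> 1" and mt: "m * (b + t) = b - a"
      using a(2) b(2) \<open>a < b\<close> by (auto simp: m_def)
    have "(1 - m) * b + m * (- t) = a" using mt by (simp add: algebra_simps)
    then have "(1 - m) * yb + m * (- q) \<le> ya"
      using combination[OF bK sym[OF lower_mem] m] upper[OF a, of "(1 - m) * yb + m * (- q)"] by simp
    moreover have "m * (yb + q) \<le> m * (\<beta> * (b + t))"
      using lower_support[OF sym[OF bK]] m by (intro mult_left_mono) (auto simp: algebra_simps)
    moreover have "m * (\<beta> * (b + t)) = \<beta> * (b - a)" by (simp only: mt[symmetric] ac_simps)
    ultimately show "yb - ya \<le> \<beta> * (b - a)" by (simp add: algebra_simps)
  qed
  have bound: "\<bar>v\<bar> \<le> \<bar>g\<bar> * \<bar>h\<bar>" if "\<alpha> * h \<le> v" "v \<le> \<beta> * h" "0 < h" for v h :: real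
  proof -
    have "- \<bar>g\<bar> * h \<le> \<alpha> * h" "\<beta> * h \<le> \<bar>g\<bar> * h"
      using that(3) g by (intro mult_right_mono; simp)+
    then show ?thesis using that by (simp only: abs_of_pos abs_le_iff) linarith
  qed
  note z1' = z1[folded n_def] and z2' = z2[folded n_def]
  consider "s1 < s2" | "s2 < s1" | "s1 = s2" by linarith
  then show ?thesis
  proof cases
    case 1
    then show ?thesis
      using slope[OF z1' z2'] bound[of "s2 - s1" "y2 - y1"] by (simp add: abs_minus_commute)
  next
    case 2
    then show ?thesis
      using slope[OF z2' z1'] bound[of "s1 - s2" "y1 - y2"] by simp
  next
    case 3
    then have "y1 = y2"
      using upper[OF z1', of y2] upper[OF z2', of y1] frontier_in_K[OF z1(1)] frontier_in_K[OF z2(1)]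
      by simp
    then show ?thesis using 3 by simp
  qed
qed

text \<open>By the slope bound, the first coordinate is injective along the arc, and each piece has
  length at most \<open>sqrt (1 + g\<^sup>2)\<close> times its horizontal extent. The arc projects
  into an interval of length \<open>2 * t\<close>.\<close>

lemma upper_arc_length:
  assumes g: "\<bar>\<alpha>\<bar> \<le> \<bar>g\<bar>" "\<bar>\<beta>\<bar> \<le> \<bar>g\<bar>"
    and \<gamma>: "arc_length_parametrization \<gamma> L (frontier K)"
  defines "E \<equiv> {r \<in> {0<..<L}. \<bar>fst (\<gamma> r)\<bar> < t \<and> (p + q) / 2 / t * fst (\<gamma> r) < snd (\<gamma> r)}"
  shows "open E" and "emeasure lborel E \<le> ennreal (sqrt (1 + g\<^sup>2) * (2 * t))"
proof -
  have cont: "continuous_on {0..L} \<gamma>" and im: "\<gamma> ` {0..L} = frontier K" and inj: "inj_on \<gamma> {0..<L}"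
    and len: "\<And>a b. 0 \<le> a \<Longrightarrow> a \<le> b \<Longrightarrow> b \<le> L \<Longrightarrow> curve_length \<gamma> a b = ennreal (b - a)"
    using \<gamma> by (auto simp: arc_length_parametrization_def)
  have cont': "continuous_on {0<..<L} \<gamma>" using cont by (rule continuous_on_subset) auto
  have "E = {r \<in> {0<..<L}. \<bar>fst (\<gamma> r)\<bar> < t}
      \<inter> {r \<in> {0<..<L}. (p + q) / 2 / t * fst (\<gamma> r) < snd (\<gamma> r)}" by (auto simp: E_def)
  moreover have "open {r \<in> {0<..<L}. \<bar>fst (\<gamma> r)\<bar> < t}"
    by (intro open_Collect_less_on continuous_intros cont' open_greaterThanLessThan)
  moreover have "open {r \<in> {0<..<L}. (p + q) / 2 / t * fst (\<gamma> r) < snd (\<gamma> r)}"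
    by (intro open_Collect_less_on continuous_intros cont' open_greaterThanLessThan)
  ultimately show op: "open E" by (simp add: open_Int)
  have EL: "r \<in> {0<..<L}" if "r \<in> E" for r using that by (simp add: E_def)
  show "emeasure lborel E \<le> ennreal (sqrt (1 + g\<^sup>2) * (2 * t))"
  proof (cases "t = 0")
    case True
    then have "E = {}" by (auto simp: E_def)
    then show ?thesis by simp
  next
    case False
    then have t: "0 < t" using t0 by simp
    have dist: "dist (\<gamma> a) (\<gamma> b) \<le> sqrt (1 + g\<^sup>2) * \<bar>fst (\<gamma> a) - fst (\<gamma> b)\<bar>"
      if "a \<in> E" "b \<in> E" for a b
    proof -
      have fr: "(fst (\<gamma> r), snd (\<gamma> r)) \<in> frontier K" if "r \<in> E" for r
        using EL[OF that] im by auto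
      have "\<bar>snd (\<gamma> a) - snd (\<gamma> b)\<bar> \<le> \<bar>g\<bar> * \<bar>fst (\<gamma> a) - fst (\<gamma> b)\<bar>"
        using that by (intro upper_arc_slope[OF t g] fr) (auto simp: E_def)
      then show ?thesis using dist_le_slope[of "snd (\<gamma> a)" "snd (\<gamma> b)" g "fst (\<gamma> a)" "fst (\<gamma> b)"] by simp
    qed
    have cE: "continuous_on E (\<lambda>r. fst (\<gamma> r))"
      by (intro continuous_intros continuous_on_subset[OF cont']) (auto dest: EL)
    have iE: "inj_on (\<lambda>r. fst (\<gamma> r)) E"
    proof (rule inj_onI)
      fix a b assume ab: "a \<in> E" "b \<in> E" "fst (\<gamma> a) = fst (\<gamma> b)"
      then have "\<gamma> a = \<gamma> b" using dist[of a b] by simp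
      then show "a = b" using inj EL[OF ab(1)] EL[OF ab(2)] by (auto dest: inj_onD)
    qed
    have "emeasure lborel E \<le> ennreal (sqrt (1 + g\<^sup>2) * (t - - t))"
    proof (rule emeasure_lborel_le_if_inj_expanding[OF op cE iE])
      show "(\<lambda>r. fst (\<gamma> r)) ` E \<subseteq> {- t..t}" by (auto simp: E_def)
      fix a b assume ab: "a < b" "{a..b} \<subseteq> E"
      then have "a \<in> E" "b \<in> E" by auto
      then have "ennreal (b - a) = curve_length \<gamma> a b" using ab EL[of a] EL[of b] by (simp add: len)
      also have "\<dots> \<le> ennreal (sqrt (1 + g\<^sup>2) * \<bar>fst (\<gamma> a) - fst (\<gamma> b)\<bar>)"
        using ab by (intro curve_length_le_inj continuous_on_subset[OF cE] inj_on_subset[OF iE] dist) auto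
      finally show "b - a \<le> sqrt (1 + g\<^sup>2) * \<bar>fst (\<gamma> a) - fst (\<gamma> b)\<bar>"
        by simp
    qed (use t in auto)
    then show ?thesis by simp
  qed
qed

text \<open>Up to finitely many parameters, the curve in the strip consists of the upper arc and of
  the lower arc, which is the upper arc of the reflected curve.\<close>

lemma middle_length:
  assumes g: "\<bar>\<alpha>\<bar> \<le> \<bar>g\<bar>" "\<bar>\<beta>\<bar> \<le> \<bar>g\<bar>"
    and \<gamma>: "arc_length_parametrization \<gamma> L (frontier K)"
  shows "measure lborel {r \<in> {0..L}. \<bar>fst (\<gamma> r)\<bar> \<le> t} \<le> 4 * t * sqrt (1 + g\<^sup>2)"
proof -
  define E where "E \<delta> = {r \<in> {0<..<L}. \<bar>fst (\<delta> r)\<bar> < t \<and> (p + q) / 2 / t * fst (\<delta> r) < snd (\<delta> r)}"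
    for \<delta> :: "real \<Rightarrow> real \<times> real"
  have \<gamma>': "arc_length_parametrization (\<lambda>r. - \<gamma> r) L (frontier K)"
    using arc_length_parametrization_minus[OF \<gamma>] by (simp add: frontier_minus)
  have op: "open (E \<gamma>)" "open (E (\<lambda>r. - \<gamma> r))"
    and le: "emeasure lborel (E \<gamma>) \<le> ennreal (sqrt (1 + g\<^sup>2) * (2 * t))"
      "emeasure lborel (E (\<lambda>r. - \<gamma> r)) \<le> ennreal (sqrt (1 + g\<^sup>2) * (2 * t))"
    unfolding E_def by (fact upper_arc_length[OF g \<gamma>] upper_arc_length[OF g \<gamma>'])+
  define V where "V = {(t, p), (t, q), (- t, - p), (- t, - q)}"
  \<comment> \<open>Parameters that the open arcs miss: those of the ends of both chords, finitely
    many by injectivity, and the two ends of the parameter interval.\<close>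
  define Z where "Z = (\<gamma> -` V \<inter> {0..<L}) \<union> {0, L}"
  have inj: "inj_on \<gamma> {0..<L}" and im: "\<gamma> ` {0..L} = frontier K"
    using \<gamma> by (auto simp: arc_length_parametrization_def)
  have fin: "finite Z" unfolding Z_def
    using finite_vimage_IntI[of V \<gamma> "{0..<L}"] inj by (auto simp: V_def)
  then have Z: "Z \<in> sets borel" by (intro borel_closed finite_imp_closed)
  \<comment> \<open>Between its ends the chord is interior to \<open>K\<close>, so the frontier
    meets the line \<open>s = t\<close> only at the ends.\<close>
  have vert: "y = p \<or> y = q" if "(t, y) \<in> frontier K" for y
  proof (rule ccontr)
    assume "\<not> (y = p \<or> y = q)"
    then have "q < y" "y < p" using ends[of y] frontier_in_K[OF that] by auto
    then have "(t, y) \<in> interior K"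
      using vertical_interior[OF mid_int upper_mem, of y] vertical_interior[OF mid_int lower_mem, of y]
      by (cases "(p + q) / 2 \<le> y") auto
    then show False using that by (simp add: frontier_def)
  qed
  have minus: "(- s, - y) \<in> frontier K" if "(s, y) \<in> frontier K" for s y
  proof -
    have "- (s, y) \<in> uminus ` frontier K" using that by (rule imageI)
    then show ?thesis by (simp add: frontier_minus)
  qed
  have cover: "{r \<in> {0..L}. \<bar>fst (\<gamma> r)\<bar> \<le> t} \<subseteq> (E \<gamma> \<union> E (\<lambda>r. - \<gamma> r)) \<union> Z"
  proof
    fix r assume r: "r \<in> {r \<in> {0..L}. \<bar>fst (\<gamma> r)\<bar> \<le> t}"
    obtain s y where sy: "\<gamma> r = (s, y)" by fastforce
    have fr: "(s, y) \<in> frontier K" using r sy im by (metis (lifting) imageI mem_Collect_eq)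
    have s: "\<bar>s\<bar> \<le> t" using r sy by simp
    show "r \<in> (E \<gamma> \<union> E (\<lambda>r. - \<gamma> r)) \<union> Z"
    proof (cases "r = 0 \<or> r = L")
      case True
      then show ?thesis by (auto simp: Z_def)
    next
      case False
      then have rL: "r \<in> {0<..<L}" using r by auto
      consider "s = t" | "s = - t" | "\<bar>s\<bar> < t" using s by linarith
      then show ?thesis
      proof cases
        case 1
        then show ?thesis using vert fr rL sy by (auto simp: Z_def V_def)
      next
        case 2
        then have "- y = p \<or> - y = q" using vert minus[OF fr] by simp
        then have "y = - p \<or> y = - q" by auto
        then show ?thesis using 2 rL sy by (auto simp: Z_def V_def)
      next
        case 3
        have "(p + q) / 2 / t * s \<noteq> y"
        proof
          assume eq: "(p + q) / 2 / t * s = y"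
          have "(s, y) \<in> interior K" using axis_interior[of s] 3 eq by simp
          then show False using fr by (simp add: frontier_def)
        qed
        then consider "(p + q) / 2 / t * s < y" | "y < (p + q) / 2 / t * s" by linarith
        then show ?thesis using 3 rL sy by cases (auto simp: E_def)
      qed
    qed
  qed
  have "emeasure lborel {r \<in> {0..L}. \<bar>fst (\<gamma> r)\<bar> \<le> t}
      \<le> emeasure lborel ((E \<gamma> \<union> E (\<lambda>r. - \<gamma> r)) \<union> Z)"
    using cover op Z by (intro emeasure_mono) auto
  also have "\<dots> \<le> emeasure lborel (E \<gamma> \<union> E (\<lambda>r. - \<gamma> r)) + emeasure lborel Z"
    using op Z by (intro emeasure_subadditive) auto
  also have "emeasure lborel Z = 0" using fin finite_imp_null_set_lborel by blast
  also have "emeasure lborel (E \<gamma> \<union> E (\<lambda>r. - \<gamma> r)) + 0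
      \<le> emeasure lborel (E \<gamma>) + emeasure lborel (E (\<lambda>r. - \<gamma> r))"
    using op by (simp, intro emeasure_subadditive) auto
  also have "\<dots> \<le> ennreal (sqrt (1 + g\<^sup>2) * (2 * t)) + ennreal (sqrt (1 + g\<^sup>2) * (2 * t))"
    by (intro add_mono le)
  also have "\<dots> = ennreal (4 * t * sqrt (1 + g\<^sup>2))"
    using t0 by (simp flip: ennreal_plus)
  finally show ?thesis unfolding measure_def using t0 by (intro enn2real_leI) auto
qed

end

section \<open>Comparison of the length and area fractions of the strip\<close>

lemma (in sym_planar_body) length_area:
  assumes "0 \<le> t" and \<gamma>: "arc_length_parametrization \<gamma> L (frontier K)"
  shows "measure lborel {r \<in> {0..L}. \<bar>fst (\<gamma> r)\<bar> \<le> t} * measure lebesgue K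
    \<le> L * measure lebesgue (K \<inter> {z. \<bar>fst z\<bar> \<le> t})"
proof -
  define F where "F = {r \<in> {0..L}. \<bar>fst (\<gamma> r)\<bar> \<le> t}"
  define R where "R = {r \<in> {0..L}. t < fst (\<gamma> r)}"
  define S where "S = {r \<in> {0..L}. t < fst (- \<gamma> r)}"
  define A where "A = K \<inter> {z. \<bar>fst z\<bar> \<le> t}"
  define C where "C = K \<inter> {z. t \<le> fst z}"
  have cont: "continuous_on {0..L} \<gamma>" and L: "0 < L"
    using \<gamma> by (auto simp: arc_length_parametrization_def)
  have RS: "R \<in> sets borel" "S \<in> sets borel"
    unfolding R_def S_def by (intro borel_Collect_less_on continuous_intros cont)+
  have F_eq: "F = {0..L} - (R \<union> S)" by (auto simp: F_def R_def S_def abs_le_iff)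
  then have Fb: "F \<in> sets borel" using RS by auto
  have fin: "emeasure lborel X \<noteq> \<infinity>" if "X \<subseteq> {0..L}" for X
    using emeasure_bounded_finite[OF bounded_subset[OF bounded_closed_interval that]] by auto
  have sub: "R \<subseteq> {0..L}" "S \<subseteq> {0..L}" "F \<subseteq> {0..L}" by (auto simp: R_def S_def F_def)
  have dj: "R \<inter> S = {}" "F \<inter> (R \<union> S) = {}" using assms(1) by (auto simp: R_def S_def F_def)
  have "{0..L} = F \<union> (R \<union> S)" using F_eq sub by blast
  then have "measure lborel {0..L} = measure lborel F + (measure lborel R + measure lborel S)"
    using RS Fb fin sub dj by (simp add: measure_Union)
  then have total: "measure lborel F + (measure lborel R + measure lborel S) = L" using L by simp
  show ?thesis
  proof (cases "\<exists>s0 y0. (s0, y0) \<in> K \<and> t < s0")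
    \<comment> \<open>With no point of \<open>K\<close> beyond the line, symmetry puts all of
      \<open>K\<close> into the strip, and only \<open>measure lborel F \<le> L\<close>
      remains.\<close>
    case False
    then have "\<bar>s\<bar> \<le> t" if "(s, y) \<in> K" for s y
      using that sym[OF that] by (auto simp: abs_le_iff not_less)
    then have "K \<inter> {z. \<bar>fst z\<bar> \<le> t} = K" by auto
    moreover have "measure lborel F \<le> L" using total by (smt (verit) measure_nonneg)
    ultimately show ?thesis by (simp add: F_def mult_right_mono)
  next
    case True
    then obtain p q \<alpha> \<beta> where "chord K t p q \<alpha> \<beta>" using chord_exists[OF assms(1)] by blast
    then interpret chord K t p q \<alpha> \<beta> .
    obtain g where g: "\<alpha> \<le> g" "g \<le> \<beta>" "\<bar>\<alpha>\<bar> \<le> \<bar>g\<bar>" "\<bar>\<beta>\<bar> \<le> \<bar>g\<bar>" using steepest_slope .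
    obtain x b where x: "0 < x" "(t + x, (p + q) / 2 + g * x) \<in> K"
      "\<And>s y. (s, y) \<in> K \<Longrightarrow> (s - t) + b * (y - (p + q) / 2 - g * (s - t)) \<le> x"
      using exit_point[of g] by blast
    define \<phi> where "\<phi> = sqrt (1 + g\<^sup>2)"
    have \<phi>: "0 \<le> \<phi>" by (simp add: \<phi>_def)
    have \<gamma>': "arc_length_parametrization (\<lambda>r. - \<gamma> r) L (frontier K)"
      using arc_length_parametrization_minus[OF \<gamma>] by (simp add: frontier_minus)
    have caps: "2 * x * \<phi> \<le> measure lborel R" "2 * x * \<phi> \<le> measure lborel S"
      unfolding R_def S_def \<phi>_def using cap_length[OF x(1,2) \<gamma>] cap_length[OF x(1,2) \<gamma>'] .
    have F_le: "measure lborel F \<le> 4 * t * \<phi>"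
      unfolding F_def \<phi>_def by (rule middle_length[OF g(3,4) \<gamma>])
    have A_ge: "2 * t * (p - q) \<le> measure lebesgue A" unfolding A_def by (rule middle_area)
    have C_le: "measure lebesgue C \<le> x * (p - q)" unfolding C_def by (rule cap_area[OF g(1,2) x(2,3)])
    have "K = (A \<union> C) \<union> uminus ` C"
    proof
      show "K \<subseteq> (A \<union> C) \<union> uminus ` C"
      proof
        fix z assume z: "z \<in> K"
        obtain s y where zz: "z = (s, y)" by fastforce
        have "- z \<in> K" using sym z by (simp add: zz)
        then have "z \<in> uminus ` C" if "s \<le> - t" using that by (intro image_eqI[of _ _ "- z"]) (auto simp: C_def zz)
        moreover have "z \<in> A \<or> z \<in> C" if "- t \<le> s" using that z by (auto simp: A_def C_def zz abs_le_iff)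
        ultimately show "z \<in> (A \<union> C) \<union> uminus ` C" by (cases "s \<le> - t") auto
      qed
      show "(A \<union> C) \<union> uminus ` C \<subseteq> K" using sym by (auto simp: A_def C_def)
    qed
    moreover have cA: "compact A" "compact C" unfolding A_def C_def
      by (intro compact_Int_closed cp closed_Collect_le continuous_intros)+
    moreover have "compact (uminus ` C)"
      by (intro compact_continuous_image continuous_intros cA)
    ultimately have "measure lebesgue K \<le> measure lebesgue A + measure lebesgue C + measure lebesgue (uminus ` C)"
      using measure_Un_le[of "A \<union> C" lebesgue "uminus ` C"] measure_Un_le[of A lebesgue C]
      by (simp add: lmeasurable_compact fmeasurableD compact_imp_closed)
    moreover have "measure lebesgue (uminus ` C) = measure lebesgue C"
      using measure_lebesgue_affine[of "-1" 0 C] by simp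
    ultimately have K_le: "measure lebesgue K \<le> measure lebesgue A + 2 * (x * (p - q))" using C_le by simp
    \<comment> \<open>Middle length times cap area is traded for cap length times strip area; the
      factors \<open>\<phi>\<close> and \<open>p - q\<close> agree on both sides. Then
      \<open>F\<close>, \<open>R\<close> and \<open>S\<close> add up to \<open>L\<close>.\<close>
    have "measure lborel F * measure lebesgue K
        \<le> measure lborel F * measure lebesgue A + measure lborel F * (2 * (x * (p - q)))"
      using mult_left_mono[OF K_le, of "measure lborel F"] by (simp add: distrib_left)
    also have "measure lborel F * (2 * (x * (p - q))) \<le> (4 * t * \<phi>) * (2 * (x * (p - q)))"
      using F_le x(1) qp by (intro mult_right_mono) auto
    also have "(4 * t * \<phi>) * (2 * (x * (p - q))) = (4 * x * \<phi>) * (2 * t * (p - q))" by simp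
    also have "\<dots> \<le> (measure lborel R + measure lborel S) * measure lebesgue A"
      using caps A_ge x(1) \<phi> qp t0 by (intro mult_mono) auto
    finally have "measure lborel F * measure lebesgue K \<le> L * measure lebesgue A"
      using total by (simp add: distrib_right[symmetric])
    then show ?thesis by (simp add: F_def A_def)
  qed
qed

section \<open>Rotation to coordinates\<close>

text \<open>The coordinate map pulls boxes back to boxes of equal volume, and boxes determine
  Lebesgue measure.\<close>

lemma distr_lborel_cart2:
  "distr lborel borel (\<lambda>z :: real ^ 2. (z $ 1, z $ 2)) = (lborel :: (real \<times> real) measure)"
proof (rule lborel_eqI[symmetric])
  have [measurable]: "(\<lambda>z :: real ^ 2. (z $ 1, z $ 2)) \<in> borel_measurable borel"
    by (intro borel_measurable_continuous_onI continuous_intros)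
  fix l u :: "real \<times> real" assume le: "\<And>b. b \<in> Basis \<Longrightarrow> l \<bullet> b \<le> u \<bullet> b"
  have le': "fst l \<le> fst u" "snd l \<le> snd u"
    using le[of "(1, 0)"] le[of "(0, 1)"] by (auto simp: Basis_prod_def inner_prod_def)
  define v :: "real \<times> real \<Rightarrow> real ^ 2" where "v z = (\<chi> i. if i = 1 then fst z else snd z)" for z
  have Basis2: "Basis = {axis 1 1, axis 2 1 :: real ^ 2}"
    by (auto simp: Basis_vec_def UNIV_2)
  have ne: "axis 1 1 \<noteq> (axis 2 1 :: real ^ 2)" by (simp add: axis_eq_axis)
  have "(\<lambda>z :: real ^ 2. (z $ 1, z $ 2)) -` box l u = box (v l) (v u)"
    by (auto simp: mem_box Basis2 Basis_prod_def inner_prod_def inner_axis v_def)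
  then have "emeasure (distr lborel borel (\<lambda>z :: real ^ 2. (z $ 1, z $ 2))) (box l u)
      = emeasure lborel (box (v l) (v u))"
    by (subst emeasure_distr) auto
  also have "\<dots> = (\<Prod>b\<in>Basis. (v u - v l) \<bullet> b)"
    using le' by (intro emeasure_lborel_box) (auto simp: Basis2 inner_axis v_def)
  also have "(\<Prod>b\<in>Basis. (v u - v l) \<bullet> b) = (\<Prod>b\<in>Basis. (u - l) \<bullet> b)"
    using ne by (simp add: Basis2 inner_axis v_def Basis_prod_def inner_prod_def)
  finally show "emeasure (distr lborel borel (\<lambda>z :: real ^ 2. (z $ 1, z $ 2))) (box l u)
      = (\<Prod>b\<in>Basis. (u - l) \<bullet> b)" .
qed simp

lemma measure_cart2_image:
  assumes "compact (A :: (real ^ 2) set)"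
  shows "measure lebesgue ((\<lambda>z. (z $ 1, z $ 2)) ` A) = measure lebesgue A"
proof -
  let ?J = "\<lambda>z :: real ^ 2. (z $ 1, z $ 2)"
  have J: "?J \<in> borel_measurable borel"
    by (intro borel_measurable_continuous_onI continuous_intros)
  have cJ: "compact (?J ` A)" by (intro compact_continuous_image continuous_intros assms)
  have inj: "inj ?J" by (auto simp: inj_def vec_eq_iff forall_2)
  have "measure lborel (?J ` A) = measure (distr lborel borel ?J) (?J ` A)"
    by (simp only: distr_lborel_cart2)
  also have "\<dots> = measure lborel (?J -` (?J ` A))"
    using cJ J by (subst measure_distr) (auto simp: compact_imp_closed)
  also have "?J -` (?J ` A) = A" using inj by (simp add: inj_vimage_image_eq)
  finally show ?thesis using cJ assms by (simp add: compact_imp_closed)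
qed

text \<open>Moving the centre to 0, rotating \<open>u\<close> to the first axis and reading off
  coordinates gives an isometry \<open>T\<close>. It preserves curve length and area and turns the
  strip into a bound on \<open>fst\<close>.\<close>

lemma planar_length_area:
  fixes K :: "(real ^ 2) set"
  assumes K: "convex_body K" "centrally_symmetric K c" and \<gamma>: "arc_length_parametrization \<gamma> L (frontier K)"
    and u: "norm u = 1" and t: "0 \<le> t"
  shows "measure lborel {r \<in> {0..L}. \<bar>(\<gamma> r - c) \<bullet> u\<bar> \<le> t} * measure lebesgue K
    \<le> L * measure lebesgue (K \<inter> {z. \<bar>(z - c) \<bullet> u\<bar> \<le> t})"
proof -
  have cv: "convex K" and compact_K: "compact K" and "interior K \<noteq> {}"
    using K(1) by (auto simp: convex_body_def)
  have sym: "2 *\<^sub>R c - z \<in> K" if "z \<in> K" for z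
    using K(2) that by (auto simp: centrally_symmetric_def)
  obtain f :: "real ^ 2 \<Rightarrow> real ^ 2" where f: "orthogonal_transformation f" "f u = axis 1 1"
    using orthogonal_transformation_exists_1[of u "axis 1 1"] u by auto
  have lf: "linear f" and injf: "inj f"
    using f(1) orthogonal_transformation_linear orthogonal_transformation_inj by blast+
  have dist_f: "dist (f a) (f b) = dist a b" for a b
    using f(1) by (simp only: orthogonal_transformation_isometry)
  define J where "J z = (z $ 1, z $ 2)" for z :: "real ^ 2"
  define F where "F z = J (f z)" for z
  define T where "T z = F (z - c)" for z
  have lJ: "linear J" unfolding J_def by (auto intro!: linearI)
  have lF: "linear F" unfolding F_def using lf lJ linear_compose[of f J] by (simp add: o_def)
  have injJ: "inj J" by (auto simp: inj_def J_def vec_eq_iff forall_2)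
  have surjJ: "surj J"
  proof (rule surjI)
    fix z show "J (\<chi> i. if i = 1 then fst z else snd z) = z" by (simp add: J_def)
  qed
  have surjf: "surj f" using f(1) orthogonal_transformation_surj by blast
  have bF: "bij F"
    unfolding F_def using injf injJ surjf surjJ bij_comp[of f J] by (simp add: bij_def o_def)
  have "inj T" using injD[OF bij_is_inj[OF bF]] by (intro injI) (fastforce simp: T_def)
  have T_image: "T ` A = F ` ((+) (- c) ` A)" for A by (auto simp: T_def image_image)
  have fst_T: "fst (T z) = (z - c) \<bullet> u" for z
  proof -
    have "fst (T z) = f (z - c) \<bullet> f u" by (simp add: T_def F_def J_def f(2) inner_axis)
    then show ?thesis using f(1) by (simp add: orthogonal_transformation_def)
  qed
  have dist_T: "dist (T a) (T b) = dist a b" for a b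
  proof -
    have "dist (J a) (J b) = dist a b" for a b
      by (simp add: J_def dist_Pair_Pair dist_vec_def L2_set_def UNIV_2)
    then have "dist (T a) (T b) = dist (a - c) (b - c)" by (simp only: T_def F_def dist_f)
    also have "\<dots> = dist a b" by (simp add: dist_norm)
    finally show ?thesis .
  qed
  have cT: "continuous_on A T" for A
  proof -
    have "continuous_on UNIV F" using lF by (intro linear_continuous_on) (simp add: linear_linear)
    then have "continuous_on A (\<lambda>z. F (z - c))"
      by (rule continuous_on_compose2) (auto intro!: continuous_intros)
    then show ?thesis by (simp only: T_def[abs_def])
  qed
  have meas: "measure lebesgue (T ` A) = measure lebesgue A" if "compact A" for A
  proof -
    have c1: "compact ((+) (- c) ` A)" using that by (rule compact_translation)
    have c2: "compact (f ` ((+) (- c) ` A))" 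
      using lf by (intro compact_continuous_image linear_continuous_on c1) (simp add: linear_linear)
    have "T ` A = J ` (f ` ((+) (- c) ` A))" by (simp add: T_image F_def image_image)
    then have "measure lebesgue (T ` A) = measure lebesgue (f ` ((+) (- c) ` A))"
      using measure_cart2_image[OF c2] by (simp add: J_def)
    also have "\<dots> = measure lebesgue ((+) (- c) ` A)"
      using c1 by (intro measure_orthogonal_image f(1) lmeasurable_compact)
    finally show ?thesis by (simp only: measure_translation)
  qed
  have interior_T: "interior (T ` K) = T ` interior K"
    by (simp only: T_image interior_bijective_linear_image[OF lF bF] interior_translation)
  have cTK: "compact (T ` K)" by (intro compact_continuous_image cT compact_K)
  have frontier_T: "frontier (T ` K) = T ` frontier K"
    using \<open>inj T\<close> cTK compact_K by (simp add: frontier_def interior_T compact_imp_closed image_set_diff)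
  interpret sym_planar_body "T ` K"
  proof
    show "convex (T ` K)"
      unfolding T_image using cv by (intro convex_linear_image lF convex_translation)
    show "compact (T ` K)" by fact
    \<comment> \<open>The centre is the midpoint of an interior point and its reflection, hence
      interior.\<close>
    obtain z where z: "z \<in> interior K" using \<open>interior K \<noteq> {}\<close> by blast
    then have "2 *\<^sub>R c - z \<in> K" using sym interior_subset by blast
    then have "(1 - 1 / 2) *\<^sub>R z + (1 / 2) *\<^sub>R (2 *\<^sub>R c - z) \<in> interior K"
      by (intro convex_interior_combination cv z) auto
    moreover have "(1 - 1 / 2) *\<^sub>R z + (1 / 2) *\<^sub>R (2 *\<^sub>R c - z) = c"
      by (simp add: algebra_simps)
    ultimately have "T c \<in> interior (T ` K)" by (simp add: interior_T)
    then show "0 \<in> interior (T ` K)" using linear_0[OF lF] by (simp add: T_def)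
    fix s y assume "(s, y) \<in> T ` K"
    then obtain z where z: "z \<in> K" "T z = (s, y)" by force
    have "T (2 *\<^sub>R c - z) = F (- (z - c))" by (simp add: T_def scaleR_2)
    also have "\<dots> = - T z" by (simp only: T_def linear_neg[OF lF])
    finally have "T (2 *\<^sub>R c - z) = (- s, - y)" using z(2) by simp
    then show "(- s, - y) \<in> T ` K" using sym[OF z(1)] by (metis imageI)
  qed
  have cl: "curve_length (\<lambda>r. T (\<gamma> r)) a b = curve_length \<gamma> a b" for a b
    by (simp add: curve_length_def dist_T)
  have "arc_length_parametrization (\<lambda>r. T (\<gamma> r)) L (frontier (T ` K))"
    unfolding arc_length_parametrization_def cl frontier_T
  proof (intro conjI)
    show "continuous_on {0..L} (\<lambda>r. T (\<gamma> r))"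
      using \<gamma> continuous_on_compose[of "{0..L}" \<gamma> T] cT
      by (simp add: arc_length_parametrization_def o_def)
    have "\<gamma> ` {0..L} = frontier K" using \<gamma> by (simp add: arc_length_parametrization_def)
    then show "(\<lambda>r. T (\<gamma> r)) ` {0..L} = T ` frontier K" by (metis image_image)
    have "inj_on \<gamma> {0..<L}" using \<gamma> by (simp add: arc_length_parametrization_def)
    then show "inj_on (\<lambda>r. T (\<gamma> r)) {0..<L}"
      using injD[OF \<open>inj T\<close>] by (auto simp: inj_on_def)
  qed (use \<gamma> in \<open>simp_all add: arc_length_parametrization_def\<close>)
  from length_area[OF t this]
  have "measure lborel {r \<in> {0..L}. \<bar>(\<gamma> r - c) \<bullet> u\<bar> \<le> t} * measure lebesgue (T ` K)
    \<le> L * measure lebesgue (T ` K \<inter> {z. \<bar>fst z\<bar> \<le> t})"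
    by (simp add: fst_T)
  moreover have "T ` K \<inter> {z. \<bar>fst z\<bar> \<le> t} = T ` (K \<inter> {z. \<bar>(z - c) \<bullet> u\<bar> \<le> t})"
    by (auto simp: fst_T)
  moreover have "compact (K \<inter> {z. \<bar>(z - c) \<bullet> u\<bar> \<le> t})"
    by (intro compact_Int_closed compact_K closed_Collect_le continuous_intros)
  ultimately show ?thesis by (simp add: meas compact_K)
qed

section \<open>From lengths and areas to probabilities\<close>

lemma prob_uniformly_distributed:
  assumes "uniformly_distributed M \<mu> A Z" "emeasure \<mu> A \<noteq> 0" "emeasure \<mu> A \<noteq> \<infinity>"
    and "A \<in> sets \<mu>" "B \<in> sets \<mu>" "space \<mu> = UNIV"
  shows "\<P>(\<omega> in M. Z \<omega> \<in> B) = measure \<mu> (A \<inter> B) / measure \<mu> A"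
proof -
  have Z: "Z \<in> measurable M \<mu>" and d: "distr M \<mu> Z = uniform_measure \<mu> A"
    using assms(1) by (auto simp: uniformly_distributed_def)
  have "\<P>(\<omega> in M. Z \<omega> \<in> B) = measure (distr M \<mu> Z) B"
    using Z assms(5) by (subst measure_distr) (auto intro!: arg_cong[of _ _ "measure M"])
  also have "\<dots> = measure \<mu> (A \<inter> B) / measure \<mu> A"
    unfolding d using assms by (intro measure_uniform_measure) auto
  finally show ?thesis .
qed

theorem theorem1:
  fixes K :: "(real ^ 2) set" and c :: "real ^ 2"
    and M :: "'p measure" and X Y :: "'p \<Rightarrow> real ^ 2" and \<sigma> :: "(real ^ 2) measure"
  assumes "convex_body K"
    and "centrally_symmetric K c"
    and "prob_space M"
    and "uniformly_distributed M lborel K X"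
    and "is_arc_length_measure \<sigma> (frontier K)"
    and "uniformly_distributed M \<sigma> (frontier K) Y"
  shows "\<forall>u :: real ^ 2. norm u = 1 \<longrightarrow> (\<forall>t :: real. 0 \<le> t \<longrightarrow>
           \<P>(\<omega> in M. norm (proj_line u (Y \<omega> - c)) \<le> t)
             \<le> \<P>(\<omega> in M. norm (proj_line u (X \<omega> - c)) \<le> t))"
proof (intro allI impI)
  fix u :: "real ^ 2" and t :: real
  assume u: "norm u = 1" and t: "0 \<le> t"
  define B where "B = {z. \<bar>(z - c) \<bullet> u\<bar> \<le> t}"
  have B: "norm (proj_line u (z - c)) \<le> t \<longleftrightarrow> z \<in> B" for z
    using u by (simp add: proj_line_def B_def)
  have "closed B" unfolding B_def by (intro closed_Collect_le continuous_intros)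
  then have Bb: "B \<in> sets borel" by simp
  have cp: "compact K" and int: "interior K \<noteq> {}"
    using assms(1) by (auto simp: convex_body_def)
  have Kb: "K \<in> sets borel" using cp by (rule borel_compact)
  have Kfin: "emeasure lborel K \<noteq> \<infinity>"
    using emeasure_bounded_finite[OF compact_imp_bounded[OF cp]] by auto
  have Kpos: "emeasure lborel K \<noteq> 0"
  proof
    assume "emeasure lborel K = 0"
    then have "K \<in> null_sets lborel" using Kb by auto
    then have "negligible K" by (simp add: negligible_iff_null_sets null_sets_completionI)
    then have "negligible (interior K)" using interior_subset negligible_subset by blast
    then show False using int open_not_negligible by blast
  qed
  then have mK: "0 < measure lborel K" using Kfin by (simp add: measure_def enn2real_positive_iff less_top zero_less_iff_neq_zero)
  obtain \<gamma> L where \<gamma>: "arc_length_parametrization \<gamma> L (frontier K)"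
    and \<sigma>: "\<sigma> = distr (restrict_space lborel {0..L}) borel \<gamma>"
    using assms(5) by (auto simp: is_arc_length_measure_def)
  have L: "0 < L" and cont: "continuous_on {0..L} \<gamma>" and im: "\<gamma> ` {0..L} = frontier K"
    using \<gamma> by (auto simp: arc_length_parametrization_def)
  have \<gamma>m: "\<gamma> \<in> measurable (restrict_space lborel {0..L}) borel"
    using borel_measurable_continuous_on_restrict[OF cont]
    by (simp add: measurable_def sets_restrict_space space_restrict_space)
  \<comment> \<open>Arc length of a set is the Lebesgue measure of the parameters that lead into it,
    so the whole frontier has mass \<open>L\<close>.\<close>
  have \<sigma>_emeasure: "emeasure \<sigma> S = emeasure lborel {r \<in> {0..L}. \<gamma> r \<in> S}" if "S \<in> sets borel" for S
  proof -
    have "emeasure \<sigma> S = emeasure (restrict_space lborel {0..L}) {r \<in> {0..L}. \<gamma> r \<in> S}"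
      unfolding \<sigma> using \<gamma>m that
      by (subst emeasure_distr) (auto simp: space_restrict_space intro!: arg_cong2[of _ _ _ _ emeasure])
    then show ?thesis by (simp add: emeasure_restrict_space subset_eq)
  qed
  have Fb: "frontier K \<in> sets borel" by simp
  have "{r \<in> {0..L}. \<gamma> r \<in> frontier K} = {0..L}" using im by auto
  then have \<sigma>F: "emeasure \<sigma> (frontier K) = ennreal L" using \<sigma>_emeasure[OF Fb] L by simp
  have "{r \<in> {0..L}. \<gamma> r \<in> frontier K \<inter> B} = {r \<in> {0..L}. \<bar>(\<gamma> r - c) \<bullet> u\<bar> \<le> t}"
    using im by (auto simp: B_def)
  then have \<sigma>FB: "measure \<sigma> (frontier K \<inter> B) = measure lborel {r \<in> {0..L}. \<bar>(\<gamma> r - c) \<bullet> u\<bar> \<le> t}"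
    using \<sigma>_emeasure[of "frontier K \<inter> B"] Fb Bb by (simp add: measure_def)
  have "\<P>(\<omega> in M. Y \<omega> \<in> B) = measure \<sigma> (frontier K \<inter> B) / measure \<sigma> (frontier K)"
    using \<sigma>F L Bb Fb by (intro prob_uniformly_distributed[OF assms(6)]) (auto simp: \<sigma>)
  also have "\<dots> = measure lborel {r \<in> {0..L}. \<bar>(\<gamma> r - c) \<bullet> u\<bar> \<le> t} / L"
    unfolding \<sigma>FB using \<sigma>F L by (simp add: measure_eq_emeasure_eq_ennreal)
  \<comment> \<open>The inequality between products, divided by \<open>L\<close> and by the area of
    \<open>K\<close>, both positive.\<close>
  also have "\<dots> \<le> measure lborel (K \<inter> B) / measure lborel K"
    using planar_length_area[OF assms(1,2) \<gamma> u t] L mK Kb Bb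
    by (simp add: B_def[symmetric] field_simps)
  also have "\<dots> = \<P>(\<omega> in M. X \<omega> \<in> B)"
    using Kpos Kfin Kb Bb by (intro prob_uniformly_distributed[OF assms(4), symmetric]) auto
  finally show "\<P>(\<omega> in M. norm (proj_line u (Y \<omega> - c)) \<le> t)
      \<le> \<P>(\<omega> in M. norm (proj_line u (X \<omega> - c)) \<le> t)"
    by (simp only: B)
qed

end
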